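(* Let $d\ge2$ and $n\ge3$. The number of fully commutative elements in the group $G(d,d,n)$ is equal to $$\sum_{k=0}^n C(n,k)\,|\mathcal P(n,k)| = (d-1)\,\mathfrak F_{n,n-2}(d)+C_n,$$ where $|\mathcal P(n,k)|$ is the number of collections in the packet $\mathcal P(n,k)$ of $G(d,d,n)$.
   Context: Numbers: $C(n,k)=\frac{(n+k)!\,(n-k+1)}{k!\,(n+1)!}$ for $0\le k\le n$; $C_n=\frac1{n+1}\binom{2n}{n}$; $\mathfrak F_{n,k}(x)=\sum_{s=0}^{k}C(n,s)x^{k-s}$. Group: $G(d,1,n)$ is the group generated by $s_1,\dots,s_n$ with defining relations $s_n^d=1$; $s_i^2=1$ $(1\le i\le n-1)$; $s_is_j=s_js_i$ $(j+1<i\le n)$; $s_{i+1}s_is_{i+1}=s_is_{i+1}s_i$ $(1\le i\le n-2)$; $s_ns_{n-1}s_ns_{n-1}=s_{n-1}s_ns_{n-1}s_n$. Canonical words: put $s_{ij}=s_is_{i-1}\cdots s_j$ if $i>j$, $s_{ii}=s_i$, $s_{ij}=$ the empty word if $i<j$; and $s^{(k)}_{nj}=s_n^k s_{n-1,j}$ for $k\ge1$, $1\le j\le n$. Every element of $G(d,1,n)$ has a unique canonical (reduced) word $s_{1i_1}s_{2i_2}\cdots s_{n-1,i_{n-1}}\,s^{(k_1)}_{nj_1}\cdots s^{(k_\ell)}_{nj_\ell}$ with $1\le i_p\le p+1$ for $1\le p\le n-1$, $\ell\ge0$, $1\le j_1<\cdots<j_\ell\le n$, $1\le k_p\le d-1$.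 The set of canonical words is $\mathcal W(d,1,n)$. The left factor $s_{1i_1}\cdots s_{n-1,i_{n-1}}$ is the prefix and the right factor $s^{(k_1)}_{nj_1}\cdots s^{(k_\ell)}_{nj_\ell}$ is the suffix. The subgroup $G(d,d,n)$ ($d\ge2$, $n\ge3$): the complex reflection group $G(d,d,n)$ is identified, via a fixed embedding, with the subgroup of $G(d,1,n)$ generated by $s_1,\dots,s_{n-1}$ and $s_n^{d-1}s_{n-1}s_n$; it consists of the elements whose canonical words satisfy $k_1+\cdots+k_\ell\equiv0\pmod d$. Full commutativity: for $w\in G(d,1,n)$, $R(w)$ is the set of words in $s_1,\dots,s_n$ of minimal length representing $w$; $w$ is fully commutative if any element of $R(w)$ can be obtained from any other using only the commutations $s_is_j=s_js_i$ $(j+1<i\le n)$ on adjacent letters. An element of $G(d,d,n)$ is fully commutative if it is fully commutative as an element of $G(d,1,n)$. A canonical word is fully commutative if the element it represents is. Collections: for a suffix $\boldsymbol w'$, the collection $\mathbf c^n_{\boldsymbol w'}$ is the set of fully commutative words in $\mathcal W(d,1,n)$ whose suffix is $\boldsymbol w'$. Packets of $G(d,1,n)$ (all exponents $t,t_i$ range over $1,\dots,d-1$): the $(n,0)$-packet is the set of collections labeled by suffixes $s^{(t_1)}_{n1}s^{(t_2)}_{nj_2}\cdots s^{(t_\ell)}_{nj_\ell}$ with $\ell\ge2$, $1<j_2<\cdots<j_\ell\le n$; for $1\le k\le n-2$ the $(n,k)$-packet is the set of collections labeled by $s^{(t)}_{nk}$ or by $s^{(t_1)}_{n,k+1}s^{(t_2)}_{nj_2}\cdots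 s^{(t_\ell)}_{nj_\ell}$ with $\ell\ge2$, $k+1<j_2<\cdots<j_\ell\le n$; the $(n,n-1)$-packet is the set of collections labeled by $s_n^t$ or $s^{(t)}_{n,n-1}=s_n^ts_{n-1}$; the $(n,n)$-packet contains only the collection labeled by the empty suffix. The packet $\mathcal P(n,k)$ of $G(d,d,n)$ is the set of those collections in the $(n,k)$-packet of $G(d,1,n)$ that are contained in $G(d,d,n)$. *)

theory Defs
  imports Complex_Main "HOL-Algebra.Generated_Groups"
begin

section \<open>Groups given by generators and relations\<close>

text \<open>
  A letter \<open>(a, True)\<close> stands for the generator \<open>a\<close> and \<open>(a, False)\<close> for its formal inverse.
  A relation \<open>(l, r)\<close> is a pair of positive words. The congruence below includes free
  cancellation, so its quotient is the free group on \<open>S\<close> modulo the normal closure of the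
  elements \<open>l r\<^sup>-\<^sup>1\<close>.
\<close>

definition pos_word :: "'a list \<Rightarrow> ('a \<times> bool) list" where
  "pos_word w = map (\<lambda>a. (a, True)) w"

inductive pres_eq ::
  "'a set \<Rightarrow> ('a list \<times> 'a list) set \<Rightarrow> ('a \<times> bool) list \<Rightarrow> ('a \<times> bool) list \<Rightarrow> bool"
  for S :: "'a set" and R :: "('a list \<times> 'a list) set"
where
  refl: "w \<in> lists (S \<times> UNIV) \<Longrightarrow> pres_eq S R w w"
| sym: "pres_eq S R u v \<Longrightarrow> pres_eq S R v u"
| trans: "pres_eq S R u v \<Longrightarrow> pres_eq S R v w \<Longrightarrow> pres_eq S R u w"
| append: "pres_eq S R u u' \<Longrightarrow> pres_eq S R v v' \<Longrightarrow> pres_eq S R (u @ v) (u' @ v')"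
| cancel: "a \<in> S \<Longrightarrow> pres_eq S R [(a, b), (a, \<not> b)] []"
| relation: "(l, r) \<in> R \<Longrightarrow> pres_eq S R (pos_word l) (pos_word r)"

definition pres_class ::
  "'a set \<Rightarrow> ('a list \<times> 'a list) set \<Rightarrow> ('a \<times> bool) list \<Rightarrow> ('a \<times> bool) list set" where
  "pres_class S R w = {v. pres_eq S R w v}"

definition presented_group ::
  "'a set \<Rightarrow> ('a list \<times> 'a list) set \<Rightarrow> ('a \<times> bool) list set monoid" where
  "presented_group S R =
     \<lparr>carrier = pres_class S R ` lists (S \<times> UNIV),
      mult = (\<lambda>A B. {w. \<exists>a\<in>A. \<exists>b\<in>B. pres_eq S R (a @ b) w}),
      one = pres_class S R []\<rparr>"

lemma pres_eq_in_lists: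
  assumes "R \<subseteq> lists S \<times> lists S" "pres_eq S R u v"
  shows "u \<in> lists (S \<times> UNIV) \<and> v \<in> lists (S \<times> UNIV)"
  using assms(2)
proof induction
  case (relation l r)
  then have "l \<in> lists S" "r \<in> lists S" using assms(1) by auto
  then show ?case by (auto simp: pos_word_def)
qed auto

lemma pres_class_eqI: "pres_eq S R u v \<Longrightarrow> pres_class S R u = pres_class S R v"
  unfolding pres_class_def by (auto intro: pres_eq.sym pres_eq.trans)

lemma mult_pres_class:
  assumes "u \<in> lists (S \<times> UNIV)" "v \<in> lists (S \<times> UNIV)"
  shows "pres_class S R u \<otimes>\<^bsub>presented_group S R\<^esub> pres_class S R v = pres_class S R (u @ v)"
proof -
  have "pres_eq S R (u @ v) w" if "pres_eq S R u a" "pres_eq S R v b" "pres_eq S R (a @ b) w"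
    for a b w
    using that by (blast intro: pres_eq.append pres_eq.trans)
  moreover have "pres_eq S R u u" "pres_eq S R v v"
    using assms by (auto intro: pres_eq.refl)
  ultimately show ?thesis
    unfolding presented_group_def pres_class_def by auto
qed

lemma pres_eq_inverse_word:
  "w \<in> lists (S \<times> UNIV) \<Longrightarrow> pres_eq S R (rev (map (\<lambda>(a, b). (a, \<not> b)) w) @ w) []"
proof (induction w)
  case Nil
  show ?case by (simp add: pres_eq.refl)
next
  case (Cons x w)
  obtain a b where x: "x = (a, b)" by fastforce
  let ?v = "rev (map (\<lambda>(a, b). (a, \<not> b)) w)"
  have a: "a \<in> S" and w: "w \<in> lists (S \<times> UNIV)" using Cons.prems x by auto
  have v: "?v \<in> lists (S \<times> UNIV)" using w by (auto simp: in_lists_conv_set)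
  have "pres_eq S R [(a, \<not> b), (a, b)] []"
    using pres_eq.cancel[OF a, of R "\<not> b"] by simp
  from pres_eq.append[OF pres_eq.refl[OF v] pres_eq.append[OF this pres_eq.refl[OF w]]]
  have "pres_eq S R (?v @ [(a, \<not> b), (a, b)] @ w) (?v @ w)" by simp
  with Cons.IH[OF w] show ?case using x by (auto intro: pres_eq.trans)
qed

lemma group_presented_group: "group (presented_group S R)"
proof (rule groupI)
  fix x y z
  assume "x \<in> carrier (presented_group S R)" "y \<in> carrier (presented_group S R)"
    "z \<in> carrier (presented_group S R)"
  then obtain u v w where "x = pres_class S R u" "u \<in> lists (S \<times> UNIV)"
    "y = pres_class S R v" "v \<in> lists (S \<times> UNIV)" "z = pres_class S R w" "w \<in> lists (S \<times> UNIV)"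
    unfolding presented_group_def by auto
  then show "x \<otimes>\<^bsub>presented_group S R\<^esub> y \<otimes>\<^bsub>presented_group S R\<^esub> z =
      x \<otimes>\<^bsub>presented_group S R\<^esub> (y \<otimes>\<^bsub>presented_group S R\<^esub> z)"
    by (simp add: mult_pres_class del: in_lists_conv_set)
next
  fix x y
  assume "x \<in> carrier (presented_group S R)" "y \<in> carrier (presented_group S R)"
  then obtain u v where "x = pres_class S R u" "u \<in> lists (S \<times> UNIV)"
    "y = pres_class S R v" "v \<in> lists (S \<times> UNIV)"
    unfolding presented_group_def by auto
  then show "x \<otimes>\<^bsub>presented_group S R\<^esub> y \<in> carrier (presented_group S R)"
    by (simp add: mult_pres_class) (auto simp: presented_group_def)
next
  show "\<one>\<^bsub>presented_group S R\<^esub> \<in> carrier (presented_group S R)"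
    by (auto simp: presented_group_def)
next
  fix x
  assume "x \<in> carrier (presented_group S R)"
  then obtain u where x: "x = pres_class S R u" and u: "u \<in> lists (S \<times> UNIV)"
    unfolding presented_group_def by auto
  have one: "\<one>\<^bsub>presented_group S R\<^esub> = pres_class S R []"
    by (simp add: presented_group_def)
  show "\<one>\<^bsub>presented_group S R\<^esub> \<otimes>\<^bsub>presented_group S R\<^esub> x = x"
    using mult_pres_class[of "[]" S u R] u x one by simp
  let ?v = "rev (map (\<lambda>(a, b). (a, \<not> b)) u)"
  have v: "?v \<in> lists (S \<times> UNIV)" using u by (auto simp: in_lists_conv_set)
  have "pres_class S R ?v \<otimes>\<^bsub>presented_group S R\<^esub> x = \<one>\<^bsub>presented_group S R\<^esub>"
    using mult_pres_class[OF v u] pres_class_eqI[OF pres_eq_inverse_word[OF u]] x one by simp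
  moreover have "pres_class S R ?v \<in> carrier (presented_group S R)"
    using v by (auto simp: presented_group_def)
  ultimately show "\<exists>y\<in>carrier (presented_group S R).
      y \<otimes>\<^bsub>presented_group S R\<^esub> x = \<one>\<^bsub>presented_group S R\<^esub>" by blast
qed


section \<open>The groups \<open>G(d,1,n)\<close> and \<open>G(d,d,n)\<close>\<close>

text \<open>The generator \<open>s\<^sub>i\<close> is represented by the number \<open>i\<close>, for \<open>1 \<le> i \<le> n\<close>.\<close>

definition Gd1n_rels :: "nat \<Rightarrow> nat \<Rightarrow> (nat list \<times> nat list) set" where
  "Gd1n_rels d n =
     {(replicate d n, [])} \<union>
     {([i, i], []) | i. 1 \<le> i \<and> i \<le> n - 1} \<union>
     {([i, j], [j, i]) | i j. 1 \<le> j \<and> j + 1 < i \<and> i \<le> n} \<union>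
     {([i + 1, i, i + 1], [i, i + 1, i]) | i. 1 \<le> i \<and> i \<le> n - 2} \<union>
     {([n, n - 1, n, n - 1], [n - 1, n, n - 1, n])}"

type_synonym gelem = "(nat \<times> bool) list set"

definition Gd1n :: "nat \<Rightarrow> nat \<Rightarrow> gelem monoid" where
  "Gd1n d n = presented_group {1..n} (Gd1n_rels d n)"

definition elt :: "nat \<Rightarrow> nat \<Rightarrow> nat list \<Rightarrow> gelem" where
  "elt d n w = pres_class {1..n} (Gd1n_rels d n) (pos_word w)"

definition Gddn :: "nat \<Rightarrow> nat \<Rightarrow> gelem set" where
  "Gddn d n = generate (Gd1n d n)
     ({elt d n [i] | i. 1 \<le> i \<and> i \<le> n - 1} \<union> {elt d n (replicate (d - 1) n @ [n - 1, n])})"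


section \<open>Full commutativity\<close>

definition reduced_words :: "nat \<Rightarrow> nat \<Rightarrow> gelem \<Rightarrow> nat list set" where
  "reduced_words d n g =
     {u \<in> lists {1..n}. elt d n u = g \<and>
        (\<forall>v \<in> lists {1..n}. elt d n v = g \<longrightarrow> length u \<le> length v)}"

definition commutation_step :: "nat \<Rightarrow> (nat list \<times> nat list) set" where
  "commutation_step n =
     {(u @ [i, j] @ v, u @ [j, i] @ v) | u v i j.
        i \<in> {1..n} \<and> j \<in> {1..n} \<and> (j + 1 < i \<or> i + 1 < j)}"

definition fully_commutative :: "nat \<Rightarrow> nat \<Rightarrow> gelem \<Rightarrow> bool" where
  "fully_commutative d n g \<longleftrightarrow> g \<in> carrier (Gd1n d n) \<and>
     (\<forall>u \<in> reduced_words d n g. \<forall>v \<in> reduced_words d n g. (u, v) \<in> (commutation_step n)\<^sup>*)"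


section \<open>Canonical words\<close>

text \<open>\<open>seg i j\<close> is \<open>s\<^sub>i s\<^sub>i\<^sub>-\<^sub>1 \<dots> s\<^sub>j\<close>; it is empty for \<open>i < j\<close>.\<close>

definition seg :: "nat \<Rightarrow> nat \<Rightarrow> nat list" where
  "seg i j = rev [j..<Suc i]"

definition nseg :: "nat \<Rightarrow> nat \<Rightarrow> nat \<Rightarrow> nat list" where
  "nseg n k j = replicate k n @ seg (n - 1) j"

definition prefixes :: "nat \<Rightarrow> nat list set" where
  "prefixes n = {concat (map (\<lambda>p. seg p (i p)) [1..<n]) | i. \<forall>p \<in> {1..n - 1}. 1 \<le> i p \<and> i p \<le> p + 1}"

text \<open>The suffix with data \<open>(k\<^sub>1, j\<^sub>1), \<dots>, (k\<^sub>\<ell>, j\<^sub>\<ell>)\<close>.\<close>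

definition suffix_data :: "nat \<Rightarrow> nat \<Rightarrow> (nat \<times> nat) list \<Rightarrow> bool" where
  "suffix_data d n kjs \<longleftrightarrow> sorted_wrt (<) (map snd kjs) \<and>
     (\<forall>(k, j) \<in> set kjs. 1 \<le> k \<and> k \<le> d - 1 \<and> 1 \<le> j \<and> j \<le> n)"

definition suffix_word :: "nat \<Rightarrow> (nat \<times> nat) list \<Rightarrow> nat list" where
  "suffix_word n kjs = concat (map (\<lambda>(k, j). nseg n k j) kjs)"

definition suffixes :: "nat \<Rightarrow> nat \<Rightarrow> nat list set" where
  "suffixes d n = {suffix_word n kjs | kjs. suffix_data d n kjs}"

definition canonical_words :: "nat \<Rightarrow> nat \<Rightarrow> nat list set" where
  "canonical_words d n = {p @ q | p q. p \<in> prefixes n \<and> q \<in> suffixes d n}"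


section \<open>Collections and packets\<close>

definition collection :: "nat \<Rightarrow> nat \<Rightarrow> nat list \<Rightarrow> nat list set" where
  "collection d n q =
     {w \<in> canonical_words d n. (\<exists>p \<in> prefixes n. w = p @ q) \<and> fully_commutative d n (elt d n w)}"

definition packet_labels :: "nat \<Rightarrow> nat \<Rightarrow> nat \<Rightarrow> nat list set" where
  "packet_labels d n k =
     (if k = 0 then
        {suffix_word n kjs | kjs. suffix_data d n kjs \<and> length kjs \<ge> 2 \<and> snd (hd kjs) = 1}
      else if k \<le> n - 2 then
        {nseg n t k | t. t \<in> {1..d - 1}} \<union>
        {suffix_word n kjs | kjs. suffix_data d n kjs \<and> length kjs \<ge> 2 \<and> snd (hd kjs) = k + 1}
      else if k = n - 1 then
        {replicate t n | t. t \<in> {1..d - 1}} \<union> {replicate t n @ [n - 1] | t. t \<in> {1..d - 1}}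
      else if k = n then {[]}
      else {})"

definition packet_Gd1n :: "nat \<Rightarrow> nat \<Rightarrow> nat \<Rightarrow> nat list set set" where
  "packet_Gd1n d n k = collection d n ` packet_labels d n k"

definition packet :: "nat \<Rightarrow> nat \<Rightarrow> nat \<Rightarrow> nat list set set" where
  "packet d n k = {c \<in> packet_Gd1n d n k. elt d n ` c \<subseteq> Gddn d n}"


section \<open>Numbers\<close>

definition catalan_triangle :: "nat \<Rightarrow> nat \<Rightarrow> real" where
  "catalan_triangle n k = fact (n + k) * (real n - real k + 1) / (fact k * fact (n + 1))"

definition catalan :: "nat \<Rightarrow> real" where
  "catalan n = 1 / (real n + 1) * real ((2 * n) choose n)"

definition catalan_poly :: "nat \<Rightarrow> nat \<Rightarrow> real \<Rightarrow> real" where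
  "catalan_poly n k x = (\<Sum>s = 0..k. catalan_triangle n s * x ^ (k - s))"

end

theory Submission
  imports Defs "HOL-Library.Multiset"
begin

text \<open>
Think of an element of \<open>G(d,1,n)\<close> as a coloured word: a permutation of \<open>1, \<dots>, n\<close> in one-line
notation, each entry carrying a colour modulo \<open>d\<close>. On the right, \<open>s_i\<close> with \<open>i < n\<close> swaps the
entries at positions \<open>i\<close> and \<open>i + 1\<close>, and \<open>s_n\<close> raises the colour of the last entry. The length of a
shortest positive word is an explicit statistic \<open>wlen\<close> of the coloured word, and a minimal word can
end in \<open>s_i\<close> exactly when \<open>i\<close> is a descent; for \<open>i < n\<close> this says that two neighbours are out of
order in a certain linear order of coloured entries. An induction in the style of Matsumoto's
theorem shows that minimal words of the same coloured word represent the same group element, so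
group elements and coloured words correspond (\<open>elt_eq_iff\<close>).

The same induction governs full commutativity. Removing descents one by one, an element is fully
commutative exactly when no element below it in the weak order has two non-commuting descents.
This is a pattern condition. Reading the uncoloured entries from left to right and then the
coloured ones from right to left yields the permutation that is the prefix of the canonical word,
while the sequence of colours determines the suffix. For an uncoloured word the condition is that
this permutation avoids 321; if there are at least two coloured entries, the first at position
\<open>k + 1\<close>, then in addition the permutation has to increase after position \<open>k\<close>
(\<open>fully_commutative_iff\<close>, \<open>tail_sorted_iff\<close>). Removing the largest entry shows that the number of
these permutations satisfies the recurrence of the Catalan triangle and equals \<open>C(n,k)\<close>
(\<open>card_ballot_perms\<close>).

An element lies in \<open>G(d,d,n)\<close> exactly when its colours sum to zero modulo \<open>d\<close> (\<open>Gddn_iff\<close>). A colour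
sequence with this property has no non-zero entry or at least two of them, and
\<open>(d - 1) d^(n - 2 - k)\<close> such sequences have their first non-zero entry at position \<open>k + 1\<close>
(\<open>card_zero_sum_at\<close>), for \<open>k \<le> n - 2\<close>. These sequences are also the labels of the collections in the
packet \<open>P(n,k)\<close>: each label, taken with the empty prefix, is itself fully commutative, so collections
with different labels are different, and a collection lies in \<open>G(d,d,n)\<close> exactly when its label does.
Both sides of the theorem are therefore the sum of \<open>C(n,k) (d - 1) d^(n - 2 - k)\<close> over \<open>k \<le> n - 2\<close>, plus
the Catalan number contributed by the empty suffix.
\<close>

section \<open>Permutations without the pattern 321\<close>

text \<open>
An occurrence of 321 that begins with \<open>x\<close> is a descent among those later entries that are smaller
than \<open>x\<close>, so sortedness of this sublist excludes it.
\<close>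

fun avoids321 :: "nat list \<Rightarrow> bool" where
  "avoids321 [] \<longleftrightarrow> True"
| "avoids321 (x # xs) \<longleftrightarrow> sorted (filter (\<lambda>y. y < x) xs) \<and> avoids321 xs"

lemma avoids321_sorted: "sorted xs \<Longrightarrow> avoids321 xs"
  by (induction xs) (auto intro: sorted_wrt_filter)

lemma avoids321_swap_descent:
  "x > y \<Longrightarrow> avoids321 (as @ x # y # bs) \<Longrightarrow> avoids321 (as @ y # x # bs)"
proof (induction as)
  case Nil
  then have s: "sorted (filter (\<lambda>z. z < x) bs)" and "sorted (filter (\<lambda>z. z < y) bs)" "avoids321 bs" by auto
  then show ?case using Nil by auto
next
  case (Cons a as)
  then show ?case by (auto simp: sorted_append split: if_splits)
qed

lemma avoids321_no_double_descent:
  "x > y \<Longrightarrow> y > z \<Longrightarrow> \<not> avoids321 (as @ x # y # z # bs)"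
  by (induction as) auto

text \<open>
A word that contains 321 either contains it in three consecutive positions, or some adjacent descent
can be undone without destroying all occurrences. The latter drives the descent in the weak order.
In an occurrence beginning with the first entry \<open>w\<close>, a smaller neighbour of \<open>w\<close> can be moved in front
of \<open>w\<close>, unless it is needed as the middle entry; in that case the large entries that separate it from
the third one can be moved out of the way.
\<close>

lemma contains321_cases:
  assumes "\<not> avoids321 l"
  shows "(\<exists>as x y z bs. l = as @ x # y # z # bs \<and> x > y \<and> y > z) \<or>
         (\<exists>as x y bs. l = as @ x # y # bs \<and> x > y \<and> \<not> avoids321 (as @ y # x # bs))"
  using assms
proof (induction l)
  case Nil
  then show ?case by simp
next
  case (Cons w l)
  show ?case
  proof (cases "avoids321 l")
    case False
    from Cons.IH[OF this] show ?thesis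
    proof (elim disjE exE conjE)
      fix as x y z bs assume "l = as @ x # y # z # bs" "x > y" "y > z"
      then have "w # l = (w # as) @ x # y # z # bs \<and> x > y \<and> y > z" by simp
      then show ?thesis by blast
    next
      fix as x y bs assume "l = as @ x # y # bs" "x > y" "\<not> avoids321 (as @ y # x # bs)"
      then have "w # l = (w # as) @ x # y # bs \<and> x > y \<and> \<not> avoids321 ((w # as) @ y # x # bs)" by simp
      then show ?thesis by blast
    qed
  next
    case True
    with Cons.prems have ns: "\<not> sorted (filter (\<lambda>y. y < w) l)" by simp
    then obtain y ys where l: "l = y # ys" by (cases l) auto
    show ?thesis
    proof (cases "y < w")
      case False
      then have "filter (\<lambda>z. z < w) ys = filter (\<lambda>z. z < w) (filter (\<lambda>z. z < y) ys)"
        by (auto intro!: filter_cong)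
      moreover have "sorted (filter (\<lambda>z. z < y) ys)" using True l by simp
      ultimately have "sorted (filter (\<lambda>z. z < w) ys)" by (metis sorted_wrt_filter)
      with ns l False show ?thesis by simp
    next
      case yw: True
      show ?thesis
      proof (cases "sorted (filter (\<lambda>y. y < w) ys)")
        case False
        then have "\<not> avoids321 ([] @ y # w # ys)" by simp
        with l yw show ?thesis by blast
      next
        case srt: True
        then obtain z zs where fz: "filter (\<lambda>y. y < w) ys = z # zs"
          using ns l yw by (cases "filter (\<lambda>y. y < w) ys") auto
        with srt ns l yw have zy: "z < y" by (auto simp: not_le)
        from fz obtain bs ds where ys: "ys = bs @ z # ds" "\<forall>b\<in>set bs. \<not> b < w" "z < w"
          by (auto simp: filter_eq_Cons_iff)
        show ?thesis
        proof (cases bs rule: rev_cases)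
          case Nil
          then have "w # l = [] @ w # y # z # ds" using l ys by simp
          with yw zy show ?thesis by blast
        next
          case (snoc bs' b)
          then have "b \<ge> w" using ys by simp
          then have "w # l = (w # y # bs') @ b # z # ds" "b > z" using snoc l ys by auto
          \<comment> \<open>Only entries below \<open>w\<close> matter, and \<open>b\<close> is not one of them.\<close>
          moreover have "filter (\<lambda>y. y < w) l = filter (\<lambda>y. y < w) (y # bs' @ z # b # ds)"
            using l ys snoc \<open>b \<ge> w\<close> by simp
          with ns have "\<not> sorted (filter (\<lambda>y. y < w) (y # bs' @ z # b # ds))" by metis
          then have "\<not> avoids321 ((w # y # bs') @ z # b # ds)" by simp
          ultimately show ?thesis by blast
        qed
      qed
    qed
  qed
qed

text \<open>
The maximum can only play the largest role in an occurrence of 321.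
\<close>

lemma avoids321_insert_max:
  assumes "\<forall>x\<in>set (a @ b). x < m"
  shows "avoids321 (a @ m # b) \<longleftrightarrow> sorted b \<and> avoids321 (a @ b)"
  using assms
proof (induction a)
  case Nil
  then have "filter (\<lambda>y. y < m) b = b" by (simp add: filter_id_conv)
  then show ?case using avoids321_sorted by auto
next
  case (Cons x a)
  then show ?case by auto
qed

section \<open>The Catalan triangle\<close>

definition perm_list :: "nat \<Rightarrow> nat list \<Rightarrow> bool" where
  "perm_list n p \<longleftrightarrow> distinct p \<and> set p = {1..n}"

text \<open>
The prefixes that go with a suffix whose first coloured entry stands at position \<open>k + 1\<close> and that has
further coloured entries. For \<open>k = n\<close> the last condition is void, which is the case of the empty
suffix.
\<close>

definition ballot_perms :: "nat \<Rightarrow> nat \<Rightarrow> nat list set" where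
  "ballot_perms n k = {p. perm_list n p \<and> avoids321 p \<and> sorted (drop k p)}"

definition insert_at :: "nat \<Rightarrow> nat \<Rightarrow> nat list \<Rightarrow> nat list" where
  "insert_at j m q = take j q @ m # drop j q"

lemma perm_length: "perm_list n p \<Longrightarrow> length p = n"
  unfolding perm_list_def by (metis card_atLeastAtMost diff_Suc_1 distinct_card)

lemma perm_set: "perm_list n p \<Longrightarrow> set p = {1..n}"
  by (simp add: perm_list_def)

lemma perm_list_insert:
  "Suc n \<notin> set (a @ b) \<Longrightarrow> perm_list (Suc n) (a @ Suc n # b) \<longleftrightarrow> perm_list n (a @ b)"
proof -
  assume a: "Suc n \<notin> set (a @ b)"
  have "{1..Suc n} = insert (Suc n) {1..n}" "Suc n \<notin> {1..n}" by auto
  then have "insert (Suc n) (set (a @ b)) = {1..Suc n} \<longleftrightarrow> set (a @ b) = {1..n}"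
    using a by (metis insert_ident)
  then show ?thesis using a by (auto simp: perm_list_def)
qed

lemma finite_ballot_perms: "finite (ballot_perms n k)"
proof -
  have "ballot_perms n k \<subseteq> {p. set p \<subseteq> {1..n} \<and> length p = n}"
    unfolding ballot_perms_def using perm_length perm_set by blast
  then show ?thesis using finite_lists_length_eq[of "{1..n}" n] finite_subset by blast
qed

lemma insert_at_inj: 
  assumes "\<And>q. q \<in> A \<Longrightarrow> m \<notin> set q" shows "inj_on (insert_at j m) A"
proof (rule inj_onI)
  fix p q assume "p \<in> A" "q \<in> A" "insert_at j m p = insert_at j m q"
  then have "take j p = take j q \<and> drop j p = drop j q"
    using assms unfolding insert_at_def
    by (subst (asm) append_Cons_eq_iff) (auto dest: in_set_takeD in_set_dropD)
  then show "p = q" by (metis append_take_drop_id)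
qed

text \<open>
Remove the largest entry. If entries follow it, they increase, because the word avoids 321; and
since the word increases after position \<open>k\<close>, the largest entry is then among the first \<open>k\<close>. Hence in
this case any permutation that increases after position \<open>j < k\<close> may remain, where \<open>j\<close> entries precede
the largest one.
\<close>

lemma ballot_perms_Suc:
  assumes "k \<le> n"
  shows "ballot_perms (Suc n) k =
    insert_at n (Suc n) ` ballot_perms n k \<union> (\<Union>j<k. insert_at j (Suc n) ` ballot_perms n j)"
    (is "_ = ?R")
proof (intro equalityI subsetI)
  fix p assume p: "p \<in> ballot_perms (Suc n) k"
  then have "set p = {1..Suc n}" by (simp add: ballot_perms_def perm_list_def)
  then have "Suc n \<in> set p" by simp
  then obtain a b where ab: "p = a @ Suc n # b" by (meson split_list)
  let ?q = "a @ b"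
  have "distinct p" using p by (simp add: ballot_perms_def perm_list_def)
  then have ms: "perm_list n ?q" using p ab perm_list_insert[of n a b] by (simp add: ballot_perms_def)
  have lt: "\<forall>x\<in>set ?q. x < Suc n" using perm_set[OF ms] by auto
  have av: "sorted b" "avoids321 ?q" using p avoids321_insert_max[OF lt] ab by (auto simp: ballot_perms_def)
  have len: "length a + length b = n" using perm_length[OF ms] by simp
  have ins: "p = insert_at (length a) (Suc n) ?q" using ab by (simp add: insert_at_def)
  show "p \<in> ?R"
  proof (cases "b = []")
    case True
    then have "sorted (drop k a)" using p ab by (simp add: ballot_perms_def sorted_append)
    then have "?q \<in> ballot_perms n k" using ms av True by (simp add: ballot_perms_def)
    moreover have "length a = n" using len True by simp
    ultimately show ?thesis using ins by blast
  next
    case False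
    have "length a < k"
    proof (rule ccontr)
      assume "\<not> length a < k"
      then have "sorted (drop k a @ Suc n # b)" using p ab by (simp add: ballot_perms_def)
      then have "\<forall>x\<in>set b. Suc n \<le> x" by (simp add: sorted_append)
      moreover have "hd b \<in> set b" using False by simp
      ultimately have "Suc n \<le> hd b" "hd b < Suc n" using lt by simp_all
      then show False by simp
    qed
    moreover have "?q \<in> ballot_perms n (length a)" using ms av by (simp add: ballot_perms_def)
    ultimately show ?thesis using ins by blast
  qed
next
  have key: "insert_at j (Suc n) q \<in> ballot_perms (Suc n) k"
    if q: "q \<in> ballot_perms n j'" and j: "j = n \<and> j' = k \<or> j < k \<and> j' = j" for j j' q
  proof -
    have ms: "perm_list n q" using q by (simp add: ballot_perms_def)
    have lt: "\<forall>x\<in>set (take j q @ drop j q). x < Suc n" using perm_set[OF ms] by auto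
    have ln: "length q = n" using perm_length[OF ms] .
    have "sorted (drop j q)" using q j ln by (auto simp: ballot_perms_def)
    then have av: "avoids321 (insert_at j (Suc n) q)"
      using avoids321_insert_max[OF lt] q by (simp add: insert_at_def ballot_perms_def)
    have ms': "perm_list (Suc n) (insert_at j (Suc n) q)"
    proof -
      have "Suc n \<notin> set (take j q @ drop j q)" using lt by blast
      from perm_list_insert[OF this] show ?thesis using ms by (simp add: insert_at_def)
    qed
    have "sorted (drop k (insert_at j (Suc n) q))"
    proof (cases "j = n \<and> j' = k")
      case True
      then have "drop k (insert_at j (Suc n) q) = drop k q @ [Suc n]"
        using assms ln by (simp add: insert_at_def)
      moreover have "\<forall>x\<in>set (drop k q). x \<le> Suc n" using lt by (auto dest!: in_set_dropD)
      ultimately show ?thesis using q True by (simp add: ballot_perms_def sorted_append)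
    next
      case False
      then have jk: "j < k" "sorted (drop j q)" using j q by (auto simp: ballot_perms_def)
      then obtain i where "k = Suc (j + i)" using less_imp_Suc_add by blast
      then have "drop k (insert_at j (Suc n) q) = drop i (drop j q)"
        using jk assms ln by (simp add: insert_at_def)
      with jk show ?thesis by (metis sorted_wrt_drop)
    qed
    with av ms' show ?thesis by (simp add: ballot_perms_def)
  qed
  fix p assume "p \<in> ?R"
  then show "p \<in> ballot_perms (Suc n) k" using key by blast
qed

lemma card_ballot_perms_Suc:
  assumes "k \<le> n"
  shows "card (ballot_perms (Suc n) k) = card (ballot_perms n k) + (\<Sum>j<k. card (ballot_perms n j))"
proof -
  have notin: "Suc n \<notin> set q" if "q \<in> ballot_perms n j" for q j
    using that by (simp add: ballot_perms_def perm_list_def)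
  have inj: "inj_on (insert_at i (Suc n)) (ballot_perms n j)" for i j
    using notin by (intro insert_at_inj) auto
  have pos: "p ! j = Suc n \<and> i = j" if "p \<in> insert_at j (Suc n) ` ballot_perms n j'"
     "p \<in> insert_at i (Suc n) ` ballot_perms n i'" "i \<le> n" "j \<le> n" for p i j i' j'
  proof -
    from that obtain q q' where q: "q \<in> ballot_perms n j'" "p = take j q @ Suc n # drop j q"
      "q' \<in> ballot_perms n i'" "p = take i q' @ Suc n # drop i q'" by (auto simp: insert_at_def)
    have "length q = n" "length q' = n" using q by (auto simp: ballot_perms_def dest: perm_length)
    have "take j q = take i q'" using q notin[OF q(1)] notin[OF q(3)]
      by (metis append_Cons_eq_iff in_set_dropD in_set_takeD)
    then have "i = j" using \<open>length q = n\<close> \<open>length q' = n\<close> that by (metis length_take min.absorb2)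
    then show ?thesis using q \<open>length q = n\<close> that by (auto simp: nth_append)
  qed
  have "card (ballot_perms (Suc n) k) = card (insert_at n (Suc n) ` ballot_perms n k)
      + card (\<Union>j<k. insert_at j (Suc n) ` ballot_perms n j)"
    unfolding ballot_perms_Suc[OF assms]
  proof (rule card_Un_disjoint)
    show "insert_at n (Suc n) ` ballot_perms n k \<inter> (\<Union>j<k. insert_at j (Suc n) ` ballot_perms n j) = {}"
      using pos assms by fastforce
  qed (auto simp: finite_ballot_perms)
  also have "card (\<Union>j<k. insert_at j (Suc n) ` ballot_perms n j)
      = (\<Sum>j<k. card (insert_at j (Suc n) ` ballot_perms n j))"
    by (rule card_UN_disjoint) (use pos assms in \<open>fastforce simp: finite_ballot_perms\<close>)+
  finally show ?thesis using card_image[OF inj] by simp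
qed

lemma ballot_perms_full: "ballot_perms (Suc n) (Suc n) = ballot_perms (Suc n) n"
proof -
  have "sorted (drop n p)" if "length p = Suc n" for p :: "nat list"
  proof -
    have "length (drop n p) = Suc 0" using that by simp
    then obtain x where "drop n p = [x]" unfolding length_Suc_conv by auto
    then show ?thesis by simp
  qed
  then show ?thesis by (auto simp: ballot_perms_def dest: perm_length)
qed

text \<open>
The Pascal-type rule of the Catalan triangle. On the diagonal \<open>k = n\<close> the last term vanishes.
\<close>

lemma catalan_triangle_step:
  "catalan_triangle (Suc n) (Suc k) = catalan_triangle (Suc n) k + catalan_triangle n (Suc k)"
proof -
  define a b c where "a = (fact (n + k) :: real)" and "b = (fact k :: real)" and "c = (fact n :: real)"
  have pos: "b > 0" "c > 0" by (simp_all add: b_def c_def)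
  have f: "fact (Suc n + Suc k) = (real n + real k + 2) * (real n + real k + 1) * a"
    "fact (Suc n + k) = (real n + real k + 1) * a" "fact (n + Suc k) = (real n + real k + 1) * a"
    "fact (Suc k) = (real k + 1) * b" "fact (Suc n + 1) = (real n + 2) * (real n + 1) * c"
    "fact (n + 1) = (real n + 1) * c"
    by (simp_all add: a_def b_def c_def algebra_simps)
  have nz: "real k + 1 \<noteq> 0" "real n + 1 \<noteq> 0" "real n + 2 \<noteq> 0" by linarith+
  show ?thesis
    unfolding catalan_triangle_def f b_def[symmetric]
    using pos nz by (simp add: divide_simps) (simp add: algebra_simps)
qed

lemma sum_catalan_triangle: "(\<Sum>j\<le>k. catalan_triangle n j) = catalan_triangle (Suc n) k"
proof (induction k)
  case 0
  have "(0::real) < fact n" "real n + 1 \<noteq> 0" "real n + 2 \<noteq> 0"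
    by (simp_all add: add_nonneg_eq_0_iff)
  then show ?case by (simp add: catalan_triangle_def divide_simps)
next
  case (Suc k)
  then show ?case using catalan_triangle_step[of n k] by simp
qed

lemma catalan_triangle_diag: "catalan_triangle (Suc n) (Suc n) = catalan_triangle (Suc n) n"
  using catalan_triangle_step[of n n] by (simp add: catalan_triangle_def[of n "Suc n"])

lemma card_ballot_perms: "k \<le> n \<Longrightarrow> real (card (ballot_perms n k)) = catalan_triangle n k"
proof (induction n arbitrary: k)
  case 0
  have "ballot_perms 0 0 = {[]}" by (auto simp: ballot_perms_def perm_list_def)
  with 0 show ?case by (simp add: catalan_triangle_def)
next
  case (Suc n)
  have *: "real (card (ballot_perms (Suc n) i)) = catalan_triangle (Suc n) i" if "i \<le> n" for i
  proof -
    have "real (card (ballot_perms (Suc n) i)) = catalan_triangle n i + (\<Sum>j<i. catalan_triangle n j)"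
      using card_ballot_perms_Suc[OF that] Suc.IH that by simp
    then show ?thesis using sum_catalan_triangle[of n i] by (simp add: lessThan_Suc_atMost[symmetric])
  qed
  show ?case
  proof (cases "k = Suc n")
    case True
    then show ?thesis using * by (simp add: ballot_perms_full catalan_triangle_diag)
  qed (use * Suc.prems in simp)
qed

lemma catalan_triangle_catalan: "catalan_triangle n n = catalan n"
proof -
  have "real ((2 * n) choose n) = fact (n + n) / (fact n * fact n)"
    by (subst binomial_fact) (simp_all add: mult_2)
  moreover have "(fact (n + 1) :: real) = (real n + 1) * fact n" by (simp add: algebra_simps)
  ultimately show ?thesis unfolding catalan_triangle_def catalan_def by simp
qed

section \<open>Coloured words and the pattern condition\<close>

type_synonym cword = "(nat \<times> nat) list"

text \<open>
This is a strict linear order on entries with distinct values, read as: \<open>x\<close> is larger than \<open>y\<close>.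
Here coloured entries are larger than uncoloured ones, uncoloured entries compare by value and coloured
entries by reversed value. Neighbours \<open>x, y\<close> with this property can be swapped to shorten the element.
\<close>

definition descent :: "nat \<times> nat \<Rightarrow> nat \<times> nat \<Rightarrow> bool" where
  "descent x y \<longleftrightarrow> (if snd x = 0 then snd y = 0 \<and> fst x > fst y else snd y = 0 \<or> fst x < fst y)"

text \<open>
The prefix of the canonical word. Multiplying a permutation by a suffix takes the current last entry,
colours it and moves it left to its final position, and then continues with the new last entry and a
position further to the right. The coloured entries thus appear in the order opposite to the one they
have in the prefix.
\<close>

fun flat :: "cword \<Rightarrow> nat list" where
  "flat [] = []"
| "flat (x # f) = (if snd x = 0 then fst x # flat f else flat f @ [fst x])"

definition coloured :: "cword \<Rightarrow> bool" where
  "coloured f \<longleftrightarrow> (\<exists>x \<in> set f. snd x \<noteq> 0)"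

text \<open>
Only the first coloured entry matters. What follows it must be increasing after flattening; as soon as
a second coloured entry exists, the first one, which is read last, has to fit as well.
\<close>

fun tail_sorted :: "cword \<Rightarrow> bool" where
  "tail_sorted [] \<longleftrightarrow> True"
| "tail_sorted (x # f) \<longleftrightarrow>
    (if snd x = 0 then tail_sorted f
     else sorted (flat f) \<and> (coloured f \<longrightarrow> sorted (flat f @ [fst x])))"

text \<open>
This will turn out to characterise full commutativity. The next lemmas show that the condition is
inherited by elements that are lower in the weak order and excludes two non-commuting descents.
\<close>

definition fc_word :: "cword \<Rightarrow> bool" where
  "fc_word f \<longleftrightarrow> avoids321 (flat f) \<and> tail_sorted f"

lemma coloured_simps [simp]:
  "\<not> coloured []" "coloured (x # f) \<longleftrightarrow> snd x \<noteq> 0 \<or> coloured f"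
  "coloured (f @ g) \<longleftrightarrow> coloured f \<or> coloured g"
  by (auto simp: coloured_def)

lemma flat_append:
  "flat (f @ g) = map fst (filter (\<lambda>x. snd x = 0) f) @ flat g @ rev (map fst (filter (\<lambda>x. snd x \<noteq> 0) f))"
  by (induction f) auto

lemma flat_uncoloured: "\<not> coloured f \<Longrightarrow> flat f = map fst f"
  by (induction f) auto

lemma mset_flat: "mset (flat f) = mset (map fst f)"
  by (induction f) auto

lemma length_flat [simp]: "length (flat f) = length f"
  by (induction f) auto

lemma flat_eq_Nil [simp]: "flat f = [] \<longleftrightarrow> f = []"
  using length_flat[of f] by (metis length_0_conv)

lemma flat_cong_right: "flat g = flat g' \<Longrightarrow> flat (f @ g) = flat (f @ g')"
  by (simp add: flat_append)

text \<open>
Coloured entries compare by reversed value, but they are also read in reverse order, so descents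
between entries of the same kind are descents of the prefix. A swap of a coloured entry with an
uncoloured one is not visible in the prefix.
\<close>

lemma flat_descent:
  assumes "descent x y"
  shows "snd x \<noteq> 0 \<and> snd y = 0 \<and> flat (as @ x # y # bs) = flat (as @ y # x # bs) \<or>
         (snd x = 0 \<longleftrightarrow> snd y = 0) \<and> (\<exists>l a b r. flat (as @ x # y # bs) = l @ a # b # r \<and> a > b
             \<and> flat (as @ y # x # bs) = l @ b # a # r)"
proof (cases "snd x = 0 \<longleftrightarrow> snd y = 0")
  case True
  show ?thesis
  proof (cases "snd x = 0")
    case x: True
    let ?U = "map fst (filter (\<lambda>x. snd x = 0) as)" and ?C = "rev (map fst (filter (\<lambda>x. snd x \<noteq> 0) as))"
    have "flat (as @ x # y # bs) = ?U @ fst x # fst y # (flat bs @ ?C)"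
      "flat (as @ y # x # bs) = ?U @ fst y # fst x # (flat bs @ ?C)"
      using x True by (simp_all add: flat_append)
    moreover have "fst x > fst y" using assms x by (simp add: descent_def)
    ultimately show ?thesis using True by blast
  next
    case x: False
    let ?U = "map fst (filter (\<lambda>x. snd x = 0) as)" and ?C = "rev (map fst (filter (\<lambda>x. snd x \<noteq> 0) as))"
    have "flat (as @ x # y # bs) = (?U @ flat bs) @ fst y # fst x # ?C"
      "flat (as @ y # x # bs) = (?U @ flat bs) @ fst x # fst y # ?C"
      using x True by (simp_all add: flat_append)
    moreover have "fst y > fst x" using assms x True by (simp add: descent_def)
    ultimately show ?thesis using True by blast
  qed
next
  case False
  then have "snd x \<noteq> 0 \<and> snd y = 0" using assms by (auto simp: descent_def split: if_splits)
  then show ?thesis by (simp add: flat_append)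
qed

lemma sorted_flat_descent:
  assumes "descent x y" "sorted (flat (as @ x # y # bs) @ r)"
  shows "flat (as @ x # y # bs) = flat (as @ y # x # bs)"
  using flat_descent[OF assms(1), of as bs] assms(2) by (auto simp: sorted_append)

lemma tail_sorted_swap:
  assumes "descent x y" "tail_sorted (as @ x # y # bs)"
  shows "tail_sorted (as @ y # x # bs)"
  using assms(2)
proof (induction as)
  case Nil
  consider "snd x = 0" "snd y = 0" | "snd x \<noteq> 0" "snd y = 0" | "snd x \<noteq> 0" "snd y \<noteq> 0" "fst x < fst y"
    using assms(1) by (auto simp: descent_def split: if_splits)
  then show ?case
    by cases (use Nil in \<open>auto simp: sorted_append\<close>)
next
  case (Cons a as)
  show ?case
  proof (cases "snd a = 0")
    case True
    then show ?thesis using Cons by simp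
  next
    case False
    then have "sorted (flat (as @ x # y # bs))" using Cons.prems by simp
    then have "flat (as @ x # y # bs) = flat (as @ y # x # bs)"
      using sorted_flat_descent[OF assms(1), of as bs "[]"] by simp
    then show ?thesis using False Cons.prems by auto
  qed
qed

lemma fc_word_swap:
  assumes "descent x y" "fc_word (as @ x # y # bs)"
  shows "fc_word (as @ y # x # bs)"
proof -
  have "avoids321 (flat (as @ y # x # bs))"
    using flat_descent[OF assms(1), of as bs] assms(2) avoids321_swap_descent
    unfolding fc_word_def by metis
  then show ?thesis using tail_sorted_swap[OF assms(1)] assms(2) by (simp add: fc_word_def)
qed

lemma flat_last: "flat (as @ [(w, c)]) = flat (as @ [(w, c')])"
  by (rule flat_cong_right) simp

lemma tail_sorted_lower:
  "tail_sorted (as @ [(w, c)]) \<Longrightarrow> c \<noteq> 0 \<Longrightarrow> tail_sorted (as @ [(w, c')])"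
proof (induction as)
  case Nil
  then show ?case by simp
next
  case (Cons a as)
  then show ?case using flat_last[of as w c c'] by auto
qed

lemma fc_word_lower: "fc_word (as @ [(w, c)]) \<Longrightarrow> c \<noteq> 0 \<Longrightarrow> fc_word (as @ [(w, c')])"
  unfolding fc_word_def using tail_sorted_lower flat_last by metis

lemma tail_sorted_drop: "tail_sorted (as @ bs) \<Longrightarrow> tail_sorted bs \<or> sorted (flat bs)"
proof (induction as)
  case (Cons a as)
  then show ?case by (auto simp: flat_append sorted_append split: if_splits)
qed simp

text \<open>
Two neighbouring descents at positions \<open>i, i + 1\<close> with \<open>i + 1 < n\<close>.
\<close>

lemma fc_word_no_double_descent:
  assumes "descent x y" "descent y z"
  shows "\<not> fc_word (as @ x # y # z # bs)"
proof
  assume fc: "fc_word (as @ x # y # z # bs)"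
  show False
  proof (cases "snd x = 0")
    case True
    then have c: "snd y = 0" "snd z = 0" "fst x > fst y" "fst y > fst z"
      using assms by (auto simp: descent_def split: if_splits)
    then have "flat (as @ x # y # z # bs) = map fst (filter (\<lambda>x. snd x = 0) as) @
        fst x # fst y # fst z # (flat bs @ rev (map fst (filter (\<lambda>x. snd x \<noteq> 0) as)))"
      using True by (simp add: flat_append)
    with c fc show False
      unfolding fc_word_def by (metis avoids321_no_double_descent)
  next
    case False
    have ns: "\<not> tail_sorted (x # y # z # bs)" 
      using assms False by (auto simp: descent_def sorted_append split: if_splits)
    have "\<not> sorted (flat (x # y # z # bs))" 
      using assms False by (auto simp: descent_def sorted_append split: if_splits)
    with ns fc show False using tail_sorted_drop unfolding fc_word_def by blast
  qed
qed

text \<open>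
The descents \<open>n - 1\<close> and \<open>n\<close> together.
\<close>

lemma fc_word_no_final_descent:
  assumes "descent x y" "snd y \<noteq> 0"
  shows "\<not> fc_word (as @ [x, y])"
proof -
  have "snd x \<noteq> 0" "fst x < fst y" using assms by (auto simp: descent_def split: if_splits)
  then have "\<not> tail_sorted [x, y]" "\<not> sorted (flat [x, y])" using assms by auto
  then show ?thesis using tail_sorted_drop unfolding fc_word_def by blast
qed

text \<open>
One step of a search for two non-commuting descents: either they are present at \<open>f\<close>, in one of the
two possible forms, or \<open>f\<close> has a lower cover at which \<open>P\<close> fails, so that the search can continue there.
\<close>

inductive bad_step :: "(cword \<Rightarrow> bool) \<Rightarrow> cword \<Rightarrow> bool" for P where
  bad_step_triple: "f = as @ x # y # z # bs \<Longrightarrow> descent x y \<Longrightarrow> descent y z \<Longrightarrow> bad_step P f"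
| bad_step_final: "f = as @ [x, y] \<Longrightarrow> descent x y \<Longrightarrow> snd y \<noteq> 0 \<Longrightarrow> bad_step P f"
| bad_step_swap: "f = as @ x # y # bs \<Longrightarrow> descent x y \<Longrightarrow> \<not> P (as @ y # x # bs) \<Longrightarrow> bad_step P f"
| bad_step_lower: "f = as @ [(w, Suc c)] \<Longrightarrow> \<not> P (as @ [(w, c)]) \<Longrightarrow> bad_step P f"

lemma bad_step_Cons:
  assumes "bad_step P f" "\<And>g. \<not> P g \<Longrightarrow> \<not> Q (a # g)"
  shows "bad_step Q (a # f)"
  using assms(1)
proof cases
  case (bad_step_triple as x y z bs)
  then show ?thesis by (intro bad_step.bad_step_triple[of _ "a # as" x y z bs]) auto
next
  case (bad_step_final as x y)
  then show ?thesis by (intro bad_step.bad_step_final[of _ "a # as" x y]) auto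
next
  case (bad_step_swap as x y bs)
  then show ?thesis using assms(2) by (intro bad_step.bad_step_swap[of _ "a # as" x y bs]) auto
next
  case (bad_step_lower as w c)
  then show ?thesis using assms(2) by (intro bad_step.bad_step_lower[of _ "a # as" w c]) auto
qed

lemma bad_step_mono:
  assumes "bad_step P f" "\<And>g. \<not> P g \<Longrightarrow> \<not> Q g"
  shows "bad_step Q f"
  using assms(1)
proof cases
  case (bad_step_triple as x y z bs)
  then show ?thesis by (intro bad_step.bad_step_triple[of _ as x y z bs])
next
  case (bad_step_final as x y)
  then show ?thesis by (intro bad_step.bad_step_final[of _ as x y])
next
  case (bad_step_swap as x y bs)
  then show ?thesis using assms(2) by (intro bad_step.bad_step_swap[of _ as x y bs])
next
  case (bad_step_lower as w c)
  then show ?thesis using assms(2) by (intro bad_step.bad_step_lower[of _ as w c])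
qed

text \<open>
The last coloured entry can be moved to the right past an uncoloured one or, if it is the last entry,
have its colour reduced. Neither affects the prefix, and with this choice of \<open>P\<close> a lower cover at which
\<open>P\<close> fails is one that has the same prefix.
\<close>

lemma coloured_flat_step:
  assumes "coloured f"
  shows "bad_step (\<lambda>g. flat g \<noteq> flat f) f"
proof -
  obtain as z bs where f: "f = as @ z # bs" "snd z \<noteq> 0" "\<forall>x\<in>set bs. snd x = 0"
    using split_list_last_prop[of f "\<lambda>x. snd x \<noteq> 0"] assms by (auto simp: coloured_def)
  show ?thesis
  proof (cases bs)
    case Nil
    obtain w c where "z = (w, Suc c)" using f(2) by (metis not0_implies_Suc prod.collapse)
    then show ?thesis using f Nil flat_last by (intro bad_step_lower[of _ as w c]) auto
  next
    case (Cons y ys)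
    then have "descent z y" using f by (simp add: descent_def)
    moreover have "flat (as @ y # z # ys) = flat f"
      using f Cons flat_descent[OF \<open>descent z y\<close>, of as ys] by auto
    ultimately show ?thesis using f Cons by (intro bad_step_swap[of _ as z y ys]) auto
  qed
qed

text \<open>
Let \<open>x\<close> be the first coloured entry. A defect behind \<open>x\<close> survives the manipulations of
\<open>coloured_flat_step\<close> behind \<open>x\<close>; without further colours it is a descent of uncoloured entries, and
moving \<open>x\<close> towards it produces two neighbouring descents. If only \<open>x\<close> itself does not fit, it is too
small compared with the second coloured entry; uncoloured entries between the two can be moved to the
left of \<open>x\<close>, and the colours behind the second one can be worked off. Once the two are neighbours and
no other coloured entry follows, they yield a pair of non-commuting descents.
\<close>

lemma not_tail_sorted_step:
  assumes "\<not> tail_sorted f" "distinct (map fst f)"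
  shows "bad_step tail_sorted f"
  using assms
proof (induction f)
  case Nil
  then show ?case by simp
next
  case (Cons x f)
  show ?case
  proof (cases "snd x = 0")
    case True
    then show ?thesis using Cons by (intro bad_step_Cons[of tail_sorted f]) auto
  next
    case x: False
    show ?thesis
    proof (cases "sorted (flat f)")
      case False
      show ?thesis
      proof (cases "coloured f")
        case True
        show ?thesis
          by (rule bad_step_Cons[OF coloured_flat_step[OF True]]) (use x False in auto)
      next
        case uf: False
        then have fl: "flat f = map fst f" by (rule flat_uncoloured)
        then obtain y ys where f: "f = y # ys" using False by (cases f) auto
        have y: "snd y = 0" "\<not> coloured ys" using uf f by auto
        then have xy: "descent x y" using x by (simp add: descent_def)
        show ?thesis
        proof (cases "sorted (flat ys)")
          case ys: False
          then show ?thesis using f xy x y by (intro bad_step_swap[of _ "[]" x y ys]) auto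
        next
          case ys: True
          then obtain z zs where z: "ys = z # zs" using False f y by (cases ys) auto
          then have "fst z < fst y" "snd z = 0"
            using ys False f y flat_uncoloured[of zs] by (fastforce simp: not_le)+
          then have "descent y z" using y by (simp add: descent_def)
          then show ?thesis using f z xy by (intro bad_step_triple[of _ "[]" x y z zs]) auto
        qed
      qed
    next
      case sf: True
      then have cf: "coloured f" and ns: "\<not> sorted (flat f @ [fst x])" using Cons.prems x by auto
      then obtain y ys where f: "f = y # ys" by (cases f) auto
      show ?thesis
      proof (cases "snd y = 0")
        case True
        then have "descent x y" using x by (simp add: descent_def)
        \<comment> \<open>The second coloured entry lies in \<open>ys\<close>, so the defect at \<open>x\<close> is visible without \<open>y\<close>.\<close>
        moreover have "\<not> sorted (flat ys @ [fst x])"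
        proof
          assume s: "sorted (flat ys @ [fst x])"
          have cy: "coloured ys" using cf f True by simp
          then obtain v where v: "v \<in> set (flat ys)" by (metis coloured_simps(1) flat_eq_Nil list.set_intros(1) neq_Nil_conv)
          then have "fst y \<le> v" "v \<le> fst x" using sf s f True by (auto simp: sorted_append)
          then show False using ns sf s f True by (auto simp: sorted_append)
        qed
        ultimately show ?thesis using f True x cf by (intro bad_step_swap[of _ "[]" x y ys]) auto
      next
        case y: False
        then have "fst y > fst x" using ns sf f by (auto simp: sorted_append)
        then have xy: "descent x y" using x y by (simp add: descent_def)
        show ?thesis
        proof (cases "coloured ys")
          case True
          have "bad_step (\<lambda>g. flat g \<noteq> flat ys) ys" by (rule coloured_flat_step[OF True])
          then have "bad_step (\<lambda>g. \<not> (\<exists>h. g = y # h \<and> flat h = flat ys)) (y # ys)"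
            by (rule bad_step_Cons) auto
          then have "bad_step tail_sorted (x # y # ys)"
            by (rule bad_step_Cons) (use x y ns f in auto)
          then show ?thesis using f by simp
        next
          case False
          show ?thesis
          proof (cases ys)
            case Nil
            then show ?thesis using f xy y by (intro bad_step_final[of _ "[]" x y]) auto
          next
            case (Cons z zs)
            then have "descent y z" using y False by (simp add: descent_def)
            then show ?thesis using f Cons xy by (intro bad_step_triple[of _ "[]" x y z zs]) auto
          qed
        qed
      qed
    qed
  qed
qed

lemma not_fc_word_step:
  assumes "\<not> fc_word f" "distinct (map fst f)"
  shows "bad_step fc_word f"
proof (cases "tail_sorted f")
  case False
  from not_tail_sorted_step[OF this assms(2)] show ?thesis
    by (rule bad_step_mono) (simp add: fc_word_def)
next
  case True
  then have na: "\<not> avoids321 (flat f)" using assms by (simp add: fc_word_def)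
  show ?thesis
  proof (cases "coloured f")
    case True
    from coloured_flat_step[OF this] show ?thesis
      by (rule bad_step_mono) (use na in \<open>simp add: fc_word_def\<close>)
  next
    case uf: False
    let ?u = "\<lambda>w. (w, 0::nat)"
    have f: "f = map ?u (flat f)" using uf flat_uncoloured[OF uf]
      by (auto simp: coloured_def map_idI intro!: map_idI[symmetric])
    have d: "descent (?u a) (?u b) \<longleftrightarrow> a > b" for a b by (simp add: descent_def)
    have fl: "flat (map ?u l) = l" for l by (induction l) auto
    from contains321_cases[OF na] show ?thesis
    proof (elim disjE exE conjE)
      fix as x y z bs assume a: "flat f = as @ x # y # z # bs" "x > y" "y > z"
      have "f = map ?u as @ ?u x # ?u y # ?u z # map ?u bs" by (subst f) (simp add: a)
      then show ?thesis by (rule bad_step_triple) (simp_all add: d a)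
    next
      fix as x y bs assume a: "flat f = as @ x # y # bs" "x > y" "\<not> avoids321 (as @ y # x # bs)"
      have "f = map ?u as @ ?u x # ?u y # map ?u bs" by (subst f) (simp add: a)
      moreover have "flat (map ?u as @ ?u y # ?u x # map ?u bs) = as @ y # x # bs"
        using fl[of "as @ y # x # bs"] by simp
      ultimately show ?thesis
        by (intro bad_step_swap[of _ "map ?u as" "?u x" "?u y" "map ?u bs"]) (simp_all add: d a fc_word_def)
    qed
  qed
qed

section \<open>The length of a coloured word\<close>

text \<open>
A pair of entries contributes one if it is an inversion of the prefix, and one more if its left entry
is coloured: in the canonical word that entry was moved left past the other one.
\<close>

fun pair_weight :: "nat \<times> nat \<Rightarrow> nat \<times> nat \<Rightarrow> nat" where
  "pair_weight x y = (if snd x = 0 then (if fst x > fst y then 1 else 0)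
                      else (if fst x < fst y then 2 else 1))"

declare pair_weight.simps [simp del]

text \<open>
The length of the canonical word: the inversions of the prefix, and for each coloured entry its colour
and the number of entries behind it.
\<close>

fun wlen :: "cword \<Rightarrow> nat" where
  "wlen [] = 0"
| "wlen (x # f) = snd x + (\<Sum>y\<leftarrow>f. pair_weight x y) + wlen f"

lemma sum_pair_weight_cong:
  assumes "mset (map fst f) = mset (map fst g)"
  shows "(\<Sum>y\<leftarrow>f. pair_weight x y) = (\<Sum>y\<leftarrow>g. pair_weight x y)"
proof -
  have "(\<Sum>y\<leftarrow>f. pair_weight x y) = sum_mset (image_mset (\<lambda>v. pair_weight x (v, 0)) (mset (map fst f)))" for f
    by (induction f) (auto simp: pair_weight.simps)
  then show ?thesis using assms by simp
qed

text \<open>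
The interaction of an initial segment with the rest depends only on the values in the rest.
\<close>

lemma wlen_append_cong:
  assumes "mset (map fst g) = mset (map fst h)"
  shows "wlen (f @ g) + wlen h = wlen (f @ h) + wlen g"
proof (induction f)
  case (Cons x f)
  then show ?case using sum_pair_weight_cong[of "f @ g" "f @ h" x] assms by simp
qed simp

lemma wlen_swap:
  assumes "descent x y"
  shows "wlen (as @ x # y # bs) = Suc (wlen (as @ y # x # bs))"
proof -
  have "wlen (x # y # bs) = Suc (wlen (y # x # bs))"
    using assms by (auto simp: pair_weight.simps descent_def split: if_splits)
  moreover have "wlen (as @ x # y # bs) + wlen (y # x # bs) = wlen (as @ y # x # bs) + wlen (x # y # bs)"
    by (rule wlen_append_cong) simp
  ultimately show ?thesis by simp
qed

lemma wlen_last: "wlen (as @ [(w, c)]) = wlen (as @ [(w, 0)]) + c"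
  using wlen_append_cong[of "[(w, c)]" "[(w, 0)]" as] by simp

lemma descent_cases:
  assumes "fst x \<noteq> fst y" obtains "descent x y" | "descent y x"
proof -
  have "descent x y \<or> descent y x" using assms by (auto simp: descent_def)
  then show ?thesis using that by blast
qed

lemma descent_trans: "descent x y \<Longrightarrow> descent y z \<Longrightarrow> descent x z"
  by (auto simp: descent_def split: if_splits)

section \<open>The action on coloured words\<close>

lemma pos_word_simps [simp]:
  "pos_word [] = []" "pos_word (i # u) = (i, True) # pos_word u" "pos_word (u @ v) = pos_word u @ pos_word v"
  by (simp_all add: pos_word_def)

lemma pos_word_in_lists [simp]: "pos_word u \<in> lists (S \<times> UNIV) \<longleftrightarrow> u \<in> lists S"
  by (auto simp: pos_word_def)

locale coloured_words =
  fixes d n :: nat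
  assumes d2: "2 \<le> d" and n3: "3 \<le> n"
begin

text \<open>
The flag distinguishes \<open>s_i\<close> from its formal inverse. It matters only for \<open>i = n\<close>, since the other
generators are involutions.
\<close>

definition sact :: "nat \<times> bool \<Rightarrow> cword \<Rightarrow> cword" where
  "sact l f = (if fst l < n then f[fst l - 1 := f ! fst l, fst l := f ! (fst l - 1)]
     else f[n - 1 := (fst (f ! (n - 1)), (snd (f ! (n - 1)) + (if snd l then 1 else d - 1)) mod d)])"

abbreviation act :: "nat \<Rightarrow> cword \<Rightarrow> cword" where "act i \<equiv> sact (i, True)"

abbreviation run :: "nat list \<Rightarrow> cword \<Rightarrow> cword" where "run u \<equiv> fold act u"

text \<open>
All that is needed for the defining relations to act trivially; the words that represent group
elements are those that are moreover permutations.
\<close>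

definition pre_state :: "cword \<Rightarrow> bool" where
  "pre_state f \<longleftrightarrow> length f = n \<and> (\<forall>x \<in> set f. snd x < d)"

definition state :: "cword \<Rightarrow> bool" where
  "state f \<longleftrightarrow> perm_list n (map fst f) \<and> (\<forall>x \<in> set f. snd x < d)"

definition start :: cword where
  "start = map (\<lambda>w. (w, 0)) [1..<Suc n]"

lemma state_pre_state: "state f \<Longrightarrow> pre_state f"
  using perm_length[of n "map fst f"] by (auto simp: state_def pre_state_def)

lemma state_length: "state f \<Longrightarrow> length f = n"
  using state_pre_state by (simp add: pre_state_def)

lemma state_distinct: "state f \<Longrightarrow> distinct (map fst f)"
  by (simp add: state_def perm_list_def)

lemma state_swap: "state (as @ x # y # bs) \<longleftrightarrow> state (as @ y # x # bs)"
  by (auto simp: state_def perm_list_def insert_commute)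

lemma state_last: "state (as @ [(w, c)]) \<Longrightarrow> c' < d \<Longrightarrow> state (as @ [(w, c')])"
  by (auto simp: state_def)

lemma state_start: "state start"
  using d2 by (auto simp: state_def start_def perm_list_def o_def)

lemma split_adjacent:
  assumes "length f = n" "1 \<le> i" "i < n"
  shows "\<exists>as x y bs. f = as @ x # y # bs \<and> length as = i - 1"
proof -
  have "f = take (i - 1) f @ f ! (i - 1) # f ! i # drop (Suc i) f"
    using assms id_take_nth_drop[of "i - 1" f] Cons_nth_drop_Suc[of i f] by simp
  moreover have "length (take (i - 1) f) = i - 1" using assms by simp
  ultimately show ?thesis by blast
qed

lemma split_final:
  assumes "length f = n"
  obtains as w c where "f = as @ [(w, c)]" "length as = n - 1"
proof -
  obtain as x where "f = as @ [x]" using assms n3 by (cases f rule: rev_cases) auto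
  then show ?thesis using that[of as "fst x" "snd x"] assms by auto
qed

lemma sact_swap:
  "length as = i - 1 \<Longrightarrow> 1 \<le> i \<Longrightarrow> i < n \<Longrightarrow> sact (i, b) (as @ x # y # bs) = as @ y # x # bs"
  by (cases i) (auto simp: sact_def list_update_append nth_append)

lemma sact_last:
  "length as = n - 1 \<Longrightarrow> sact (n, b) (as @ [(w, c)]) = as @ [(w, (c + (if b then 1 else d - 1)) mod d)]"
proof -
  assume "length as = n - 1"
  then have "n - 1 = length as" by simp
  then show ?thesis unfolding sact_def by simp
qed

lemma nth_sact:
  assumes "length f = n" "p < n" "1 \<le> i" "i \<le> n"
  shows "sact (i, b) f ! p = (if i < n then (if p = i - 1 then f ! i else if p = i then f ! (i - 1) else f ! p)
     else if p = n - 1 then (fst (f ! p), (snd (f ! p) + (if b then 1 else d - 1)) mod d) else f ! p)"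
  using assms by (auto simp: sact_def nth_list_update)

lemma length_sact [simp]: "length (sact l f) = length f"
  by (simp add: sact_def)

lemma pre_state_sact: "pre_state f \<Longrightarrow> 1 \<le> i \<Longrightarrow> i \<le> n \<Longrightarrow> pre_state (sact (i, b) f)"
  using d2 unfolding pre_state_def by (auto simp: all_set_conv_all_nth nth_sact)

lemma state_act: assumes "state f" "i \<in> {1..n}" shows "state (sact (i, b) f)"
proof (cases "i < n")
  case True
  then obtain as x y bs where "f = as @ x # y # bs" "length as = i - 1"
    using split_adjacent[OF state_length[OF assms(1)], of i] assms(2) by (metis atLeastAtMost_iff)
  then show ?thesis using sact_swap[of as i b x y bs] True assms state_swap by auto
next
  case False
  obtain as w c where "f = as @ [(w, c)]" "length as = n - 1"
    using split_final state_length[OF assms(1)] by metis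
  then show ?thesis using sact_last[of as b w c] False assms d2 state_last[of as w c] by auto
qed

lemma pre_state_srun: "w \<in> lists ({1..n} \<times> UNIV) \<Longrightarrow> pre_state f \<Longrightarrow> pre_state (fold sact w f)"
  by (induction w arbitrary: f) (auto simp: pre_state_sact)

lemma srun_pos_word: "fold sact (pos_word u) f = run u f"
  by (induction u arbitrary: f) auto

lemma state_run: "u \<in> lists {1..n} \<Longrightarrow> state f \<Longrightarrow> state (run u f)"
proof (induction u arbitrary: f)
  case (Cons i u)
  then show ?case using state_act[of f i True] by simp
qed simp

lemma run_replicate:
  assumes "length as = n - 1" "c < d"
  shows "run (replicate k n) (as @ [(w, c)]) = as @ [(w, (c + k) mod d)]"
  using assms by (induction k arbitrary: c) (simp_all add: sact_last mod_simps)

section \<open>The defining relations act trivially\<close>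

lemma rels_in_lists: "Gd1n_rels d n \<subseteq> lists {1..n} \<times> lists {1..n}"
  using n3 by (auto simp: Gd1n_rels_def)

lemma act_commute:
  assumes "pre_state f" "1 \<le> j" "j + 1 < i" "i \<le> n"
  shows "act j (act i f) = act i (act j f)"
proof -
  have len: "length f = n" using assms(1) by (simp add: pre_state_def)
  obtain a b where ab: "i = Suc a" "j = Suc b" using assms by (cases i; cases j) auto
  show ?thesis
  proof (rule nth_equalityI)
    fix p assume "p < length (act j (act i f))"
    then have p: "p < n" using len by simp
    consider "p = b" | "p = Suc b" | "p = a" | "p = Suc a" | "p \<notin> {a, Suc a, b, Suc b}" by blast
    then show "act j (act i f) ! p = act i (act j f) ! p"
      by cases (use p ab assms(3,4) in \<open>auto simp: nth_sact len\<close>)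
  qed simp
qed

lemma act_braid:
  assumes "pre_state f" "1 \<le> i" "i + 1 < n"
  shows "act (i + 1) (act i (act (i + 1) f)) = act i (act (i + 1) (act i f))"
proof -
  have len: "length f = n" using assms(1) by (simp add: pre_state_def)
  obtain as x y bs where f: "f = as @ x # y # bs" "length as = i - 1"
    using split_adjacent[OF len, of i] assms(2,3) by (metis Suc_eq_plus1 Suc_lessD)
  then obtain z cs where bs: "bs = z # cs" using len assms by (cases bs) auto
  have 1: "act i (as @ u # v # w # cs) = as @ v # u # w # cs" for u v w
    using f assms by (simp add: sact_swap)
  have 2: "act (i + 1) (as @ u # v # w # cs) = as @ u # w # v # cs" for u v w
    using f assms sact_swap[of "as @ [u]" "i + 1" True v w cs] by simp
  show ?thesis unfolding f bs 1 2 ..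
qed

lemma relation_sound:
  assumes "(l, r) \<in> Gd1n_rels d n" "pre_state f"
  shows "run l f = run r f"
proof -
  have len: "length f = n" using assms(2) by (simp add: pre_state_def)
  obtain as w c where f: "f = as @ [(w, c)]" "length as = n - 1" using split_final len by metis
  then have c: "c < d" using assms(2) by (simp add: pre_state_def)
  obtain bs x where as: "as = bs @ [x]" "length bs = n - 2" using f n3 by (cases as rule: rev_cases) auto
  have last2: "act (n - 1) (bs @ [y, z]) = bs @ [z, y]" for y z
    using sact_swap[of bs "n - 1" True y z "[]"] as n3 by simp
  have last1: "act n (bs @ [y, (v, e)]) = bs @ [y, (v, (e + 1) mod d)]" for y v e
    using sact_last[of "bs @ [y]" True v e] as n3 by simp
  consider "l = replicate d n" "r = []" | i where "l = [i, i]" "r = []" "1 \<le> i" "i < n"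
    | i j where "l = [i, j]" "r = [j, i]" "1 \<le> j" "j + 1 < i" "i \<le> n"
    | i where "l = [i + 1, i, i + 1]" "r = [i, i + 1, i]" "1 \<le> i" "i + 1 < n"
    | "l = [n, n - 1, n, n - 1]" "r = [n - 1, n, n - 1, n]"
    using assms(1) n3 unfolding Gd1n_rels_def by fastforce
  then show ?thesis
  proof cases
    case 1
    then show ?thesis using run_replicate[of as c d w] f c by simp
  next
    case 2
    then show ?thesis using len by (intro nth_equalityI) (auto simp: nth_sact)
  next
    case 3
    then show ?thesis using act_commute[OF assms(2)] by simp
  next
    case 4
    then show ?thesis using act_braid[OF assms(2)] by simp
  next
    case 5
    obtain v e where x: "x = (v, e)" by (cases x)
    show ?thesis unfolding 5 using f as by (simp add: x last1[simplified] last2[simplified])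
  qed
qed

lemma pres_eq_sound:
  assumes "pres_eq {1..n} (Gd1n_rels d n) u v" "pre_state f"
  shows "fold sact u f = fold sact v f"
  using assms
proof (induction arbitrary: f)
  case (append u u' v v')
  then have "pre_state (fold sact u f)"
    using pres_eq_in_lists[OF rels_in_lists] pre_state_srun by metis
  then show ?case using append by simp
next
  case (cancel a b)
  show ?case
  proof (cases "a < n")
    case True
    then show ?thesis using cancel
      by (intro nth_equalityI) (auto simp: nth_sact pre_state_def)
  next
    case False
    then have a: "a = n" using cancel by simp
    have len: "length f = n" using cancel by (simp add: pre_state_def)
    obtain as w c where f: "f = as @ [(w, c)]" "length as = n - 1" using split_final len by metis
    then have c: "c < d" using cancel by (simp add: pre_state_def)
    have "c + 1 + (d - 1) = c + d" "c + (d - 1) + 1 = c + d" using d2 by simp_all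
    then have "((c + 1) mod d + (d - 1)) mod d = c" "((c + (d - 1)) mod d + 1) mod d = c"
      using c mod_add_left_eq[of "c + 1" d "d - 1"] mod_add_left_eq[of "c + (d - 1)" d 1] by simp_all
    then show ?thesis using f a by (cases b) (simp_all add: sact_last)
  qed
next
  case (relation l r)
  then show ?case using relation_sound srun_pos_word by metis
qed simp_all

lemma elt_eq_pres_eq:
  assumes "u \<in> lists {1..n}" "v \<in> lists {1..n}"
  shows "elt d n u = elt d n v \<longleftrightarrow> pres_eq {1..n} (Gd1n_rels d n) (pos_word u) (pos_word v)"
proof
  assume "elt d n u = elt d n v"
  moreover have "pos_word v \<in> elt d n v"
    using assms by (simp add: elt_def pres_class_def pres_eq.refl del: in_lists_conv_set)
  ultimately show "pres_eq {1..n} (Gd1n_rels d n) (pos_word u) (pos_word v)"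
    by (auto simp: elt_def pres_class_def)
qed (simp add: elt_def pres_class_eqI)

lemma elt_sound:
  assumes "u \<in> lists {1..n}" "v \<in> lists {1..n}" "elt d n u = elt d n v" "pre_state f"
  shows "run u f = run v f"
  using assms elt_eq_pres_eq[OF assms(1,2)] pres_eq_sound srun_pos_word by metis

lemma elt_append:
  assumes "u \<in> lists {1..n}" "v \<in> lists {1..n}"
  shows "elt d n (u @ v) = elt d n u \<otimes>\<^bsub>Gd1n d n\<^esub> elt d n v"
  using assms unfolding elt_def Gd1n_def by (simp add: mult_pres_class del: in_lists_conv_set)

lemma elt_cong:
  assumes "elt d n l = elt d n r" "l \<in> lists {1..n}" "r \<in> lists {1..n}" "a \<in> lists {1..n}" "b \<in> lists {1..n}"
  shows "elt d n (a @ l @ b) = elt d n (a @ r @ b)"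
  using assms by (simp add: elt_append del: in_lists_conv_set)

lemma elt_relation:
  assumes "(l, r) \<in> Gd1n_rels d n" "a \<in> lists {1..n}" "b \<in> lists {1..n}"
  shows "elt d n (a @ l @ b) = elt d n (a @ r @ b)"
proof -
  have "l \<in> lists {1..n}" "r \<in> lists {1..n}" using rels_in_lists assms(1) by auto
  moreover have "elt d n l = elt d n r"
    using assms(1) by (simp add: elt_def pres_class_eqI pres_eq.relation)
  ultimately show ?thesis using elt_cong assms(2,3) by blast
qed

section \<open>Minimal words and descents\<close>

definition right_descent :: "nat \<Rightarrow> cword \<Rightarrow> bool" where
  "right_descent i f \<longleftrightarrow> (if i < n then descent (f ! (i - 1)) (f ! i) else snd (f ! (n - 1)) \<noteq> 0)"

text \<open>
For a descent \<open>i\<close>, the result of removing \<open>s_i\<close> from the right. For \<open>i = n\<close> this lowers the colour instead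
of applying the letter.
\<close>

definition low :: "nat \<Rightarrow> cword \<Rightarrow> cword" where
  "low i f = (if i < n then act i f else f[n - 1 := (fst (f ! (n - 1)), snd (f ! (n - 1)) - 1)])"

definition reduced :: "cword \<Rightarrow> nat list set" where
  "reduced f = {u \<in> lists {1..n}. run u start = f \<and> length u = wlen f}"

lemma right_descent_swap [simp]:
  "length as = i - 1 \<Longrightarrow> 1 \<le> i \<Longrightarrow> i < n \<Longrightarrow> right_descent i (as @ x # y # bs) \<longleftrightarrow> descent x y"
  by (cases i) (auto simp: right_descent_def nth_append)

lemma low_swap [simp]:
  "length as = i - 1 \<Longrightarrow> 1 \<le> i \<Longrightarrow> i < n \<Longrightarrow> low i (as @ x # y # bs) = as @ y # x # bs"
  by (simp add: low_def sact_swap)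

lemma right_descent_last [simp]: "length as = n - 1 \<Longrightarrow> right_descent n (as @ [(w, c)]) \<longleftrightarrow> c \<noteq> 0"
proof -
  assume "length as = n - 1"
  then have "n - 1 = length as" by simp
  then show ?thesis unfolding right_descent_def by simp
qed

lemma low_last [simp]: "length as = n - 1 \<Longrightarrow> low n (as @ [(w, c)]) = as @ [(w, c - 1)]"
proof -
  assume "length as = n - 1"
  then have "n - 1 = length as" by simp
  then show ?thesis unfolding low_def by simp
qed

lemma low_state:
  assumes "state f" "i \<in> {1..n}" shows "state (low i f)"
proof (cases "i < n")
  case True
  then show ?thesis using assms by (simp add: low_def state_act)
next
  case False
  obtain as w c where f: "f = as @ [(w, c)]" "length as = n - 1"
    using split_final state_length[OF assms(1)] by metis
  then have "c - 1 < d" using assms(1) by (auto simp: state_def)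
  then show ?thesis using f False assms state_last[of as w c "c - 1"] by simp
qed

lemma wlen_low:
  assumes "state f" "i \<in> {1..n}" "right_descent i f"
  shows "wlen f = Suc (wlen (low i f))"
proof (cases "i < n")
  case True
  then obtain as x y bs where "f = as @ x # y # bs" "length as = i - 1"
    using split_adjacent[OF state_length[OF assms(1)], of i] assms(2) by (metis atLeastAtMost_iff)
  then show ?thesis using assms wlen_swap True by simp
next
  case False
  then have i: "i = n" using assms by simp
  obtain as w c where f: "f = as @ [(w, c)]" "length as = n - 1"
    using split_final state_length[OF assms(1)] by metis
  then show ?thesis using assms i wlen_last[of as w c] wlen_last[of as w "c - 1"] by simp
qed

lemma act_low:
  assumes "state f" "i \<in> {1..n}" "right_descent i f"
  shows "act i (low i f) = f"
proof (cases "i < n")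
  case True
  then obtain as x y bs where "f = as @ x # y # bs" "length as = i - 1"
    using split_adjacent[OF state_length[OF assms(1)], of i] assms(2) by (metis atLeastAtMost_iff)
  then show ?thesis using assms sact_swap True by simp
next
  case False
  then have i: "i = n" using assms by simp
  obtain as w c where f: "f = as @ [(w, c)]" "length as = n - 1"
    using split_final state_length[OF assms(1)] by metis
  then have "c < d" using assms(1) by (auto simp: state_def)
  then show ?thesis using assms f i by (simp add: sact_last)
qed

text \<open>
Only the steps upwards are uniform: the length drops by one if two neighbours are put in order, but by
\<open>d - 1\<close> if the colour of the last entry jumps from \<open>d - 1\<close> to zero.
\<close>

lemma act_cases:
  assumes "state g" "i \<in> {1..n}"
  shows "right_descent i (act i g) \<and> low i (act i g) = g \<or> wlen (act i g) < wlen g"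
proof (cases "i < n")
  case True
  then obtain as x y bs where g: "g = as @ x # y # bs" "length as = i - 1"
    using split_adjacent[OF state_length[OF assms(1)], of i] assms(2) by (metis atLeastAtMost_iff)
  have "fst x \<noteq> fst y" using state_distinct[OF assms(1)] g by auto
  then show ?thesis
    by (cases rule: descent_cases) (use g assms True wlen_swap[of x y as bs] in \<open>auto simp: sact_swap\<close>)
next
  case False
  then have i: "i = n" using assms by simp
  obtain as w c where f: "g = as @ [(w, c)]" "length as = n - 1"
    using split_final state_length[OF assms(1)] by metis
  then have c: "c < d" using assms(1) by (auto simp: state_def)
  show ?thesis
  proof (cases "Suc c < d")
    case True
    then show ?thesis using f i by (simp add: sact_last)
  next
    case False
    then have "Suc c = d" using c by simp
    then show ?thesis using f i d2 wlen_last[of as w c] by (simp add: sact_last)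
  qed
qed

lemma wlen_act: assumes "state g" "i \<in> {1..n}" shows "wlen (act i g) \<le> Suc (wlen g)"
  using act_cases[OF assms] wlen_low[OF state_act[OF assms, of True] assms(2)] by auto

lemma wlen_start: "wlen start = 0"
proof -
  have "wlen (map (\<lambda>w. (w, 0)) l) = 0" if "sorted l" for l :: "nat list"
    using that by (induction l) (auto simp: pair_weight.simps)
  then show ?thesis by (simp add: start_def del: upt_Suc)
qed

lemma wlen_run: "u \<in> lists {1..n} \<Longrightarrow> wlen (run u start) \<le> length u"
proof (induction u rule: rev_induct)
  case Nil
  then show ?case by (simp add: wlen_start)
next
  case (snoc i u)
  then show ?case using wlen_act[of "run u start" i] state_run[of u start] state_start by force
qed

text \<open>
The minimal words are the words that remove one descent after the other, from right to left.
\<close>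

lemma snoc_reduced:
  assumes "state f"
  shows "u @ [i] \<in> reduced f \<longleftrightarrow> i \<in> {1..n} \<and> right_descent i f \<and> u \<in> reduced (low i f)"
proof
  assume a: "u @ [i] \<in> reduced f"
  let ?g = "run u start"
  have i: "i \<in> {1..n}" and u: "u \<in> lists {1..n}" and f: "f = act i ?g" "Suc (length u) = wlen f"
    using a by (auto simp: reduced_def)
  have g: "state ?g" using state_run[OF u state_start] .
  have "wlen ?g \<le> length u" using wlen_run[OF u] .
  then have "right_descent i f \<and> low i f = ?g" using act_cases[OF g i] f by auto
  then show "i \<in> {1..n} \<and> right_descent i f \<and> u \<in> reduced (low i f)"
    using i u f wlen_low[OF assms i] by (auto simp: reduced_def)
next
  assume "i \<in> {1..n} \<and> right_descent i f \<and> u \<in> reduced (low i f)"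
  then show "u @ [i] \<in> reduced f" using act_low[OF assms, of i] wlen_low[OF assms, of i]
    by (auto simp: reduced_def)
qed

text \<open>
The last coloured entry always gives rise to a descent. If all entries are uncoloured, an unsorted
pair of neighbours does.
\<close>

lemma exists_descent:
  assumes "state f" "f \<noteq> start"
  shows "\<exists>i \<in> {1..n}. right_descent i f"
proof (rule ccontr)
  assume no: "\<not> ?thesis"
  have len: "length f = n" using state_length assms by simp
  have nd: "\<not> descent x y" if "f = as @ x # y # bs" for as x y bs
  proof
    assume "descent x y"
    then have "right_descent (Suc (length as)) f" "Suc (length as) \<in> {1..n}" using len that by auto
    then show False using no by blast
  qed
  have uf: "\<not> coloured f"
  proof
    assume "coloured f"
    then have "bad_step (\<lambda>g. flat g \<noteq> flat f) f" by (rule coloured_flat_step)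
    then show False
    proof cases
      case (bad_step_lower as w c)
      then have "right_descent n f" using len by simp
      then show False using no n3 by auto
    qed (use nd in auto)
  qed
  have "sorted (map fst f)"
    unfolding sorted_iff_nth_Suc
  proof (intro allI impI)
    fix i assume i: "Suc i < length (map fst f)"
    have "f = take i f @ f ! i # f ! Suc i # drop (Suc (Suc i)) f"
      using i id_take_nth_drop[of i f] Cons_nth_drop_Suc[of "Suc i" f] by simp
    then have "\<not> descent (f ! i) (f ! Suc i)" by (rule nd)
    moreover have "f ! i \<in> set f" "f ! Suc i \<in> set f" using i by auto
    then have "snd (f ! i) = 0" "snd (f ! Suc i) = 0" using uf unfolding coloured_def by blast+
    ultimately show "map fst f ! i \<le> map fst f ! Suc i" using i by (simp add: descent_def)
  qed
  then have "map fst f = [1..<Suc n]"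
    using assms(1) by (intro sorted_distinct_set_unique) (auto simp: state_def perm_list_def simp del: upt_Suc)
  moreover have "f = map (\<lambda>w. (w, 0)) (map fst f)"
    using uf by (auto simp: coloured_def intro!: map_idI[symmetric])
  ultimately show False using assms(2) unfolding start_def by metis
qed

lemma reduced_nonempty: "state f \<Longrightarrow> \<exists>u. u \<in> reduced f"
proof (induction "wlen f" arbitrary: f rule: less_induct)
  case less
  show ?case
  proof (cases "f = start")
    case True
    then have "[] \<in> reduced f" by (simp add: reduced_def wlen_start)
    then show ?thesis by blast
  next
    case False
    then obtain i where i: "i \<in> {1..n}" "right_descent i f" using exists_descent less.prems by blast
    then obtain u where "u \<in> reduced (low i f)"
      using less.hyps[of "low i f"] wlen_low[OF less.prems i] low_state[OF less.prems i(1)] by auto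
    then show ?thesis using snoc_reduced[OF less.prems] i by blast
  qed
qed

section \<open>Pairs of descents\<close>

lemma length_low [simp]: "length (low i f) = length f"
  by (simp add: low_def)

lemma reduced_state: "u \<in> reduced f \<Longrightarrow> state f"
  using state_run state_start by (auto simp: reduced_def)

lemma reduced_lists: "u \<in> reduced f \<Longrightarrow> u \<in> lists {1..n}"
  by (simp add: reduced_def)

lemma append_reduced_swap:
  assumes "u \<in> reduced (as @ y # x # bs)" "descent x y" "length as = i - 1" "1 \<le> i" "i < n"
  shows "u @ [i] \<in> reduced (as @ x # y # bs)"
proof -
  have "state (as @ x # y # bs)" using reduced_state[OF assms(1)] state_swap by blast
  then show ?thesis using snoc_reduced assms by simp
qed

lemma append_reduced_last:
  assumes "u \<in> reduced (as @ [(w, c)])" "length as = n - 1" "c + k < d"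
  shows "u @ replicate k n \<in> reduced (as @ [(w, c + k)])"
  using assms(3)
proof (induction k)
  case 0
  then show ?case using assms by simp
next
  case (Suc k)
  then have "u @ replicate k n \<in> reduced (as @ [(w, c + k)])" by simp
  moreover have "state (as @ [(w, c + Suc k)])"
    using state_last[OF reduced_state[OF assms(1)] Suc.prems] .
  ultimately have "(u @ replicate k n) @ [n] \<in> reduced (as @ [(w, c + Suc k)])"
    using snoc_reduced[of "as @ [(w, c + Suc k)]" "u @ replicate k n" n] assms(2) n3 by simp
  then show ?case by (simp add: replicate_append_same)
qed

text \<open>
The next three lemmas complete a pair of descents to a common lower element with a minimal word \<open>t\<close>,
one lemma for each kind of dihedral relation. Here the two letters commute.
\<close>

lemma far_descents:
  assumes "state f" "i \<in> {1..n}" "j \<in> {1..n}" "i + 1 < j" "right_descent i f" "right_descent j f"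
  shows "\<exists>t. t @ [j] \<in> reduced (low i f) \<and> t @ [i] \<in> reduced (low j f)"
proof -
  have len: "length f = n" using state_length assms(1) .
  obtain a b where ab: "i = Suc a" "j = Suc b" using assms(2,3) by (cases i; cases j) auto
  have i: "i < n" "Suc a < b" "b < n" using assms ab by auto
  have dj: "right_descent j (low i f)" and di: "right_descent i (low j f)"
    using assms(5,6) i ab len unfolding right_descent_def low_def sact_def
    by (auto simp: nth_list_update)
  have eq: "low j (low i f) = low i (low j f)"
  proof (rule nth_equalityI)
    show "length (low j (low i f)) = length (low i (low j f))" by simp
    fix p assume "p < length (low j (low i f))"
    then have p: "p < n" using len by simp
    consider "p = b" | "p = Suc b" | "p = a" | "p = Suc a" | "p \<notin> {a, Suc a, b, Suc b}" by blast
    then show "low j (low i f) ! p = low i (low j f) ! p"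
      unfolding low_def sact_def
      by cases (use p ab i len in \<open>auto simp: nth_list_update\<close>)
  qed
  obtain t where "t \<in> reduced (low j (low i f))"
    using reduced_nonempty low_state assms by blast
  then show ?thesis using eq snoc_reduced low_state assms di dj by metis
qed

text \<open>
The three entries involved are decreasing, and in the coloured word of \<open>t\<close> they are increasing.
\<close>

lemma adjacent_descents:
  assumes "state f" "1 \<le> i" "i + 1 < n" "right_descent i f" "right_descent (i + 1) f"
  shows "\<exists>t. t @ [i, i + 1] \<in> reduced (low i f) \<and> t @ [i + 1, i] \<in> reduced (low (i + 1) f)"
proof -
  have len: "length f = n" using state_length assms(1) .
  obtain as x y bs where f: "f = as @ x # y # bs" "length as = i - 1"
    using split_adjacent[OF len, of i] assms(2,3) by (metis Suc_eq_plus1 Suc_lessD)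
  then obtain z cs where bs: "bs = z # cs" using len assms(2,3) by (cases bs) auto
  have f1: "f = as @ x # y # z # cs" and f2: "f = (as @ [x]) @ y # z # cs" using f bs by simp_all
  have xy: "descent x y" using assms f1 f(2) by simp
  have len2: "length (as @ [u]) = i + 1 - 1" for u using f(2) assms(2) by simp
  have yz: "descent y z" using assms(3,5) right_descent_swap[OF len2, of x y z cs] f2 by simp
  have xz: "descent x z" using descent_trans[OF xy yz] .
  have low: "low i f = as @ y # x # z # cs" "low (i + 1) f = as @ x # z # y # cs"
    using f1 f(2) assms f2 low_swap[OF len2, of x y z cs] by simp_all
  have "state (as @ z # y # x # cs)"
    using assms(1) f1 state_swap[of as x y "z # cs"] state_swap[of "as @ [y]" x z cs]
      state_swap[of as y z "x # cs"] by simp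
  then obtain t where t: "t \<in> reduced (as @ z # y # x # cs)" using reduced_nonempty by blast
  have "t @ [i] \<in> reduced ((as @ [y]) @ z # x # cs)"
    using append_reduced_swap[OF t yz f(2)] assms by simp
  then have "(t @ [i]) @ [i + 1] \<in> reduced ((as @ [y]) @ x # z # cs)"
    by (rule append_reduced_swap[OF _ xz]) (use len2 assms in auto)
  moreover have "(t @ [i + 1]) @ [i] \<in> reduced (as @ x # z # y # cs)"
  proof (rule append_reduced_swap[OF _ xz f(2)])
    have "t @ [i + 1] \<in> reduced ((as @ [z]) @ x # y # cs)"
      using t assms len2[of z] xy by (intro append_reduced_swap) auto
    then show "t @ [i + 1] \<in> reduced (as @ z # x # y # cs)" by simp
  qed (use assms in auto)
  ultimately show ?thesis unfolding low by auto
qed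

text \<open>
The last two entries have non-zero colours, \<open>a\<close> and \<open>b + 1\<close>, and in the coloured word of \<open>t\<close> both are
uncoloured and in increasing order. They can be coloured in either order. The two resulting words
of the element are in general not related by a single defining relation, see \<open>E_final_power\<close>.
\<close>

lemma final_descents:
  assumes "state f" "right_descent (n - 1) f" "right_descent n f"
  obtains t a b where
    "t @ [n - 1] @ replicate a n @ [n - 1] @ replicate b n \<in> reduced (low n f)"
    "t @ replicate (Suc b) n @ [n - 1] @ replicate a n \<in> reduced (low (n - 1) f)"
proof -
  have len: "length f = n" using state_length assms(1) .
  have n1: "1 \<le> n - 1" "n - 1 < n" using n3 by auto
  obtain as' w c where f: "f = as' @ [(w, c)]" "length as' = n - 1" using split_final len by metis
  obtain as x where as: "as' = as @ [x]" "length as = n - 2" using f n3 by (cases as' rule: rev_cases) auto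
  obtain v a where x: "x = (v, a)" by (cases x)
  have la: "length as = n - 1 - 1" "length (as @ [y]) = n - 1" for y using as n3 by simp_all
  have f': "f = as @ (v, a) # (w, c) # []" "f = (as @ [(v, a)]) @ [(w, c)]" using f as x by simp_all
  have "c \<noteq> 0" using assms(3) f by simp
  then obtain b where c: "c = Suc b" by (cases c) auto
  have "descent (v, a) (w, c)" using assms(2) right_descent_swap[OF la(1) n1] f'(1) by metis
  then have a: "a \<noteq> 0" "v < w" using c by (auto simp: descent_def split: if_splits)
  have lt: "a < d" "b + 1 < d" using assms(1) f' c by (auto simp: state_def)
  have D: "descent (w, 0) (v, 0)" "descent (v, a) (w, 0)" "descent (w, Suc b) (v, 0)"
    using a by (auto simp: descent_def)
  have st: "state ((as @ [(v, e)]) @ [(w, 0)])" if "e < d" for e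
  proof -
    have "state ((as @ [(v, a)]) @ [(w, 0)])" using assms(1) f' state_last[of "as @ [(v, a)]" w c 0] d2 by simp
    then show ?thesis using that by (auto simp: state_def)
  qed
  have "state (as @ [(v, 0), (w, 0)])" using st[of 0] d2 by simp
  then obtain t where t: "t \<in> reduced (as @ [(v, 0), (w, 0)])" using reduced_nonempty by blast
  have "t @ [n - 1] \<in> reduced (as @ (w, 0) # (v, 0) # [])"
    using t by (rule append_reduced_swap) (use D la n1 in auto)
  then have "(t @ [n - 1]) @ replicate a n \<in> reduced ((as @ [(w, 0)]) @ [(v, 0 + a)])"
    by (intro append_reduced_last) (use la lt in auto)
  then have "((t @ [n - 1]) @ replicate a n) @ [n - 1] \<in> reduced (as @ (v, a) # (w, 0) # [])"
    by (intro append_reduced_swap) (use D la n1 in auto)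
  then have "(((t @ [n - 1]) @ replicate a n) @ [n - 1]) @ replicate b n \<in> reduced ((as @ [(v, a)]) @ [(w, 0 + b)])"
    by (intro append_reduced_last) (use la lt in auto)
  moreover have "low n f = (as @ [(v, a)]) @ [(w, b)]" unfolding f'(2) low_last[OF la(2)] c by simp
  ultimately have 1: "t @ [n - 1] @ replicate a n @ [n - 1] @ replicate b n \<in> reduced (low n f)" by simp
  have "t @ replicate (Suc b) n \<in> reduced ((as @ [(v, 0)]) @ [(w, 0 + Suc b)])"
    by (intro append_reduced_last) (use t la lt in auto)
  then have "(t @ replicate (Suc b) n) @ [n - 1] \<in> reduced (as @ (w, Suc b) # (v, 0) # [])"
    by (intro append_reduced_swap) (use D la n1 in auto)
  then have "((t @ replicate (Suc b) n) @ [n - 1]) @ replicate a n \<in> reduced ((as @ [(w, Suc b)]) @ [(v, 0 + a)])"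
    by (intro append_reduced_last) (use la lt in auto)
  moreover have "low (n - 1) f = as @ (w, Suc b) # (v, a) # []" using f'(1) la(1) n1 c low_swap by metis
  ultimately have 2: "t @ replicate (Suc b) n @ [n - 1] @ replicate a n \<in> reduced (low (n - 1) f)" by simp
  from 1 2 that show ?thesis by blast
qed

section \<open>The word problem\<close>

abbreviation E :: "nat list \<Rightarrow> gelem" where "E \<equiv> elt d n"

lemma E_square:
  assumes "a \<in> lists {1..n}" "b \<in> lists {1..n}" "1 \<le> i" "i < n"
  shows "E (a @ [i, i] @ b) = E (a @ b)"
proof -
  have "([i, i], []) \<in> Gd1n_rels d n" using assms by (auto simp: Gd1n_rels_def)
  from elt_relation[OF this assms(1,2)] show ?thesis by simp
qed

lemma E_power:
  assumes "a \<in> lists {1..n}" "b \<in> lists {1..n}"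
  shows "E (a @ replicate d n @ b) = E (a @ b)"
proof -
  have "(replicate d n, []) \<in> Gd1n_rels d n" by (auto simp: Gd1n_rels_def)
  from elt_relation[OF this assms] show ?thesis by simp
qed

lemma E_final_braid:
  assumes "a \<in> lists {1..n}" "b \<in> lists {1..n}"
  shows "E (a @ [n, n - 1, n, n - 1] @ b) = E (a @ [n - 1, n, n - 1, n] @ b)"
proof -
  have "([n, n - 1, n, n - 1], [n - 1, n, n - 1, n]) \<in> Gd1n_rels d n" by (auto simp: Gd1n_rels_def)
  from elt_relation[OF this assms] show ?thesis .
qed

lemma in_lists_gen: "n \<in> {1..n}" "n - 1 \<in> {1..n}" "replicate k n \<in> lists {1..n}"
  using n3 by auto

text \<open>
By the relation of length four, \<open>s_{n-1} s_n s_{n-1}\<close> commutes with \<open>s_n\<close>, and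
\<open>s_{n-1} s_n^a s_{n-1}\<close> is its \<open>a\<close>-th power.
\<close>

lemma E_final_power_one:
  "E ([n - 1] @ replicate a n @ [n - 1, n]) = E ([n, n - 1] @ replicate a n @ [n - 1])"
proof (induction a)
  case 0
  have "E ([] @ [n - 1, n - 1] @ [n]) = E ([] @ [n])" "E ([n] @ [n - 1, n - 1] @ []) = E ([n] @ [])"
    by (rule E_square; use n3 in simp)+
  then show ?case by simp
next
  case (Suc a)
  have "E ([n - 1] @ replicate (Suc a) n @ [n - 1, n]) = E (([n - 1] @ replicate a n) @ [n, n - 1, n])"
    by (simp add: replicate_append_same[symmetric])
  also have "\<dots> = E (([n - 1] @ replicate a n) @ [n - 1, n - 1] @ [n, n - 1, n])"
    by (rule E_square[symmetric]) (use n3 in auto)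
  also have "\<dots> = E (([n - 1] @ replicate a n @ [n - 1]) @ [n - 1, n, n - 1, n] @ [])" by simp
  also have "\<dots> = E (([n - 1] @ replicate a n @ [n - 1]) @ [n, n - 1, n, n - 1] @ [])"
    by (rule E_final_braid[symmetric]) (use n3 in auto)
  also have "\<dots> = E ([] @ ([n - 1] @ replicate a n @ [n - 1, n]) @ [n - 1, n, n - 1])" by simp
  also have "\<dots> = E ([] @ ([n, n - 1] @ replicate a n @ [n - 1]) @ [n - 1, n, n - 1])"
    by (rule elt_cong[OF Suc.IH]) (use n3 in auto)
  also have "\<dots> = E (([n, n - 1] @ replicate a n) @ [n - 1, n - 1] @ [n, n - 1])" by simp
  also have "\<dots> = E (([n, n - 1] @ replicate a n) @ [n, n - 1])"
    by (rule E_square) (use n3 in auto)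
  also have "\<dots> = E ([n, n - 1] @ replicate (Suc a) n @ [n - 1])"
    by (simp add: replicate_append_same[symmetric])
  finally show ?case .
qed

lemma E_final_power:
  "E ([n - 1] @ replicate a n @ [n - 1] @ replicate b n) = E (replicate b n @ [n - 1] @ replicate a n @ [n - 1])"
proof (induction b)
  case 0
  then show ?case by simp
next
  case (Suc b)
  have "E ([n - 1] @ replicate a n @ [n - 1] @ replicate (Suc b) n)
      = E ([] @ ([n - 1] @ replicate a n @ [n - 1] @ replicate b n) @ [n])"
    by (simp add: replicate_append_same)
  also have "\<dots> = E ([] @ (replicate b n @ [n - 1] @ replicate a n @ [n - 1]) @ [n])"
    by (rule elt_cong[OF Suc.IH]) (use n3 in auto)
  also have "\<dots> = E (replicate b n @ ([n - 1] @ replicate a n @ [n - 1, n]) @ [])" by simp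
  also have "\<dots> = E (replicate b n @ ([n, n - 1] @ replicate a n @ [n - 1]) @ [])"
    by (rule elt_cong[OF E_final_power_one]) (use n3 in auto)
  also have "\<dots> = E (replicate (Suc b) n @ [n - 1] @ replicate a n @ [n - 1])"
    by (simp add: replicate_append_same[symmetric])
  finally show ?case .
qed

text \<open>
Two minimal words with different last letters are compared with the two words through the common
lower element, whose equality is a consequence of the relations between these two letters.
\<close>

lemma reduced_unique_aux:
  assumes IH: "\<And>g u v. wlen g < wlen f \<Longrightarrow> u \<in> reduced g \<Longrightarrow> v \<in> reduced g \<Longrightarrow> E u = E v"
    and f: "state f" and u: "u \<in> reduced (low i f)" and v: "v \<in> reduced (low j f)"
    and i: "i \<in> {1..n}" "right_descent i f" and j: "j \<in> {1..n}" "right_descent j f" and ij: "i < j"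
  shows "E (u @ [i]) = E (v @ [j])"
proof -
  have uI: "E (u @ [i]) = E (u' @ [i])" if "u' \<in> reduced (low i f)" for u'
    using elt_append IH[of "low i f" u u'] wlen_low[OF f i] u that i reduced_lists by simp
  have vJ: "E (v @ [j]) = E (v' @ [j])" if "v' \<in> reduced (low j f)" for v'
    using elt_append IH[of "low j f" v v'] wlen_low[OF f j] v that j reduced_lists by simp
  consider "i + 1 < j" | "j = i + 1" "j < n" | "j = i + 1" "j = n" using ij j by fastforce
  then show ?thesis
  proof cases
    case 1
    then obtain t where t: "t @ [j] \<in> reduced (low i f)" "t @ [i] \<in> reduced (low j f)"
      using far_descents[OF f i(1) j(1) _ i(2) j(2)] by blast
    have r: "([j, i], [i, j]) \<in> Gd1n_rels d n" using 1 i j by (auto simp: Gd1n_rels_def)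
    have "E (t @ [j, i] @ []) = E (t @ [i, j] @ [])"
      by (rule elt_relation[OF r]) (use reduced_lists[OF t(1)] in auto)
    then show ?thesis using uI[OF t(1)] vJ[OF t(2)] by simp
  next
    case 2
    then obtain t where t: "t @ [i, j] \<in> reduced (low i f)" "t @ [j, i] \<in> reduced (low j f)"
      using adjacent_descents[OF f, of i] i j by auto
    have r: "([j, i, j], [i, j, i]) \<in> Gd1n_rels d n" using 2 i by (auto simp: Gd1n_rels_def)
    have "E (t @ [j, i, j] @ []) = E (t @ [i, j, i] @ [])"
      by (rule elt_relation[OF r]) (use reduced_lists[OF t(1)] in auto)
    then show ?thesis using uI[OF t(1)] vJ[OF t(2)] by simp
  next
    case 3
    then have ni: "i = n - 1" by simp
    from final_descents[OF f] i j 3 ni obtain t a b where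
      t: "t @ [n - 1] @ replicate a n @ [n - 1] @ replicate b n \<in> reduced (low n f)"
      "t @ replicate (Suc b) n @ [n - 1] @ replicate a n \<in> reduced (low (n - 1) f)" by metis
    have tl: "t \<in> lists {1..n}" using reduced_lists[OF t(1)] by simp
    have "E (u @ [i]) = E (t @ (replicate (Suc b) n @ [n - 1] @ replicate a n @ [n - 1]) @ [])"
      using uI[of "t @ replicate (Suc b) n @ [n - 1] @ replicate a n"] t(2) ni by simp
    also have "\<dots> = E (t @ ([n - 1] @ replicate a n @ [n - 1] @ replicate (Suc b) n) @ [])"
      by (rule elt_cong[OF E_final_power[symmetric]]) (use n3 tl in auto)
    also have "\<dots> = E (v @ [j])"
      using vJ[of "t @ [n - 1] @ replicate a n @ [n - 1] @ replicate b n"] t(1) 3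
      by (simp add: replicate_append_same)
    finally show ?thesis .
  qed
qed

text \<open>
The analogue of Matsumoto's theorem. Equality in the group is all that holds in general: passing from
one minimal word to another by the defining relations may require longer words in between.
\<close>

lemma reduced_unique:
  "u \<in> reduced f \<Longrightarrow> v \<in> reduced f \<Longrightarrow> E u = E v"
proof (induction "wlen f" arbitrary: f u v rule: less_induct)
  case less
  have f: "state f" using reduced_state less.prems(1) .
  have len: "length u = wlen f" "length v = wlen f" using less.prems by (auto simp: reduced_def)
  show ?case
  proof (cases u rule: rev_cases)
    case Nil
    then show ?thesis using len by simp
  next
    case u: (snoc u' i)
    then obtain v' j where v: "v = v' @ [j]" using len by (cases v rule: rev_cases) auto
    have i: "i \<in> {1..n}" "right_descent i f" "u' \<in> reduced (low i f)" and j: "j \<in> {1..n}" "right_descent j f" "v' \<in> reduced (low j f)"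
      using less.prems snoc_reduced[OF f] u v by auto
    consider "i = j" | "i < j" | "j < i" by linarith
    then show ?thesis
    proof cases
      case 1
      then have "E u' = E v'" using less.hyps[of "low i f" u' v'] i j wlen_low[OF f i(1,2)] by simp
      then show ?thesis using u v 1 i j elt_append reduced_lists by simp
    next
      case 2
      then show ?thesis using reduced_unique_aux[OF less.hyps f i(3) j(3) i(1,2) j(1,2)] u v by simp
    next
      case 3
      then show ?thesis using reduced_unique_aux[OF less.hyps f j(3) i(3) j(1,2) i(1,2)] u v by simp
    qed
  qed
qed

text \<open>
Append letters one at a time. If the new letter shortens the word, it cancels against a minimal word
that ends in the same letter; for \<open>s_n\<close> it completes the power \<open>s_n^d\<close>.
\<close>

lemma E_eq_reduced:
  "u \<in> lists {1..n} \<Longrightarrow> r \<in> reduced (run u start) \<Longrightarrow> E u = E r"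
proof (induction u arbitrary: r rule: rev_induct)
  case Nil
  then show ?case by (simp add: reduced_def wlen_start)
next
  case (snoc i u)
  let ?g = "run u start" and ?f = "run (u @ [i]) start"
  have u: "u \<in> lists {1..n}" and i: "i \<in> {1..n}" using snoc.prems by auto
  have g: "state ?g" using state_run[OF u state_start] .
  have f: "state ?f" using state_run[OF snoc.prems(1) state_start] .
  have fg: "?f = act i ?g" by simp
  obtain s where s: "s \<in> reduced ?g" using reduced_nonempty g by blast
  have Eu: "E (u @ [i]) = E (s @ [i])"
    using snoc.IH[OF u s] elt_append u i reduced_lists[OF s] by simp
  show ?case
  proof (cases "right_descent i ?f \<and> low i ?f = ?g")
    case True
    then have "s @ [i] \<in> reduced ?f" using snoc_reduced[OF f] i s by simp
    then show ?thesis using reduced_unique snoc.prems Eu by metis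
  next
    case False
    note rl = reduced_lists[OF snoc.prems(2)]
    show ?thesis
    proof (cases "i < n")
      case True
      then obtain as x y bs where g': "?g = as @ x # y # bs" "length as = i - 1"
        using split_adjacent[OF state_length[OF g], of i] i by (metis atLeastAtMost_iff)
      then have f': "?f = as @ y # x # bs" using True i sact_swap fg by simp
      have "\<not> descent y x" using False f' g' True i by simp
      moreover have "fst x \<noteq> fst y" using state_distinct[OF g] g' by auto
      ultimately have "descent x y" by (metis descent_cases)
      then have "r @ [i] \<in> reduced ?g"
        using append_reduced_swap[of r as y x bs i] snoc.prems(2) f' g' True i by simp
      then have "E s = E (r @ [i])" using reduced_unique s by blast
      then have "E (u @ [i]) = E (r @ [i, i] @ [])" using Eu elt_append[of s "[i]"]
          elt_append[of "r @ [i]" "[i]"] rl reduced_lists[OF s] i by simp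
      also have "\<dots> = E (r @ [])" by (rule E_square) (use rl i True in auto)
      finally show ?thesis by simp
    next
      case False': False
      then have i': "i = n" using i by simp
      obtain as w c where g': "?g = as @ [(w, c)]" "length as = n - 1"
        using split_final state_length[OF g] by metis
      have c: "c < d" using g g' by (auto simp: state_def)
      have f': "?f = as @ [(w, (c + 1) mod d)]" using fg g' i' by (simp add: sact_last)
      have "c + 1 = d"
      proof (rule ccontr)
        assume "c + 1 \<noteq> d"
        then have "?f = as @ [(w, c + 1)]" using c f' by simp
        then show False using False i' g' by simp
      qed
      then have f0: "?f = as @ [(w, 0)]" and c': "c = d - 1" using f' by simp_all
      then have "r @ replicate (d - 1) n \<in> reduced ?g"
        using append_reduced_last[of r as w 0 "d - 1"] snoc.prems(2) g' d2 by simp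
      then have "E s = E (r @ replicate (d - 1) n)" using reduced_unique s by blast
      moreover have "replicate (d - 1) n @ [n] = replicate d n"
        using d2 by (cases d) (simp_all add: replicate_append_same)
      ultimately have "E (u @ [i]) = E (r @ replicate d n @ [])" using Eu elt_append[of s "[n]"]
          elt_append[of "r @ replicate (d - 1) n" "[n]"] rl reduced_lists[OF s] i i' in_lists_gen by simp
      also have "\<dots> = E (r @ [])" by (rule E_power) (use rl in auto)
      finally show ?thesis by simp
    qed
  qed
qed

text \<open>
The action is faithful: the coloured word reached from the identity determines the group element.
\<close>

theorem elt_eq_iff:
  assumes "u \<in> lists {1..n}" "v \<in> lists {1..n}"
  shows "E u = E v \<longleftrightarrow> run u start = run v start"
proof
  show "E u = E v \<Longrightarrow> run u start = run v start"
    using elt_sound[OF assms] state_pre_state[OF state_start] by blast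
  assume "run u start = run v start"
  moreover obtain r where "r \<in> reduced (run u start)"
    using reduced_nonempty state_run[OF assms(1) state_start] by blast
  ultimately show "E u = E v" using E_eq_reduced assms by metis
qed

lemma reduced_words_eq:
  assumes "u \<in> lists {1..n}"
  shows "reduced_words d n (E u) = reduced (run u start)"
proof -
  obtain r where r: "r \<in> reduced (run u start)"
    using reduced_nonempty state_run[OF assms state_start] by blast
  show ?thesis
  proof (intro equalityI subsetI)
    fix v assume "v \<in> reduced_words d n (E u)"
    then have v: "v \<in> lists {1..n}" "E v = E u" "length v \<le> length r"
      using r E_eq_reduced[OF assms r] reduced_lists[OF r] by (auto simp: reduced_words_def)
    then have "run v start = run u start" using elt_eq_iff assms by blast
    then show "v \<in> reduced (run u start)" using v wlen_run[OF v(1)] r by (auto simp: reduced_def)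
  next
    fix v assume "v \<in> reduced (run u start)"
    then have v: "v \<in> lists {1..n}" "run v start = run u start" "length v = wlen (run u start)"
      by (auto simp: reduced_def)
    then have "E v = E u" using elt_eq_iff assms by blast
    moreover have "length v \<le> length x" if "x \<in> lists {1..n}" "E x = E u" for x
      using elt_eq_iff[OF that(1) assms] wlen_run[OF that(1)] v that by simp
    ultimately show "v \<in> reduced_words d n (E u)" using v by (simp add: reduced_words_def)
  qed
qed

lemma elt_carrier: "u \<in> lists {1..n} \<Longrightarrow> E u \<in> carrier (Gd1n d n)"
  unfolding elt_def Gd1n_def presented_group_def by simp

lemma elt_surj:
  assumes "g \<in> carrier (Gd1n d n)"
  obtains u where "u \<in> lists {1..n}" "g = E u"
proof -
  let ?eq = "pres_eq {1..n} (Gd1n_rels d n)"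
  have letter: "\<exists>u \<in> lists {1..n}. ?eq [l] (pos_word u)" if l: "l \<in> {1..n} \<times> UNIV" for l
  proof -
    obtain i b where ib: "l = (i, b)" "i \<in> {1..n}" using l by auto
    show ?thesis
    proof (cases b)
      case True
      have "?eq [l] (pos_word [i])" using ib True by (simp add: pres_eq.refl)
      then show ?thesis using ib(2) by (metis lists.Cons lists.Nil)
    next
      case False
      \<comment> \<open>A positive word for the inverse of the letter.\<close>
      define p where "p = (if i < n then [i] else replicate (d - 1) n)"
      have p: "p \<in> lists {1..n}" using ib n3 by (auto simp: p_def)
      have "(i # p, []) \<in> Gd1n_rels d n"
        using ib d2 by (cases d) (auto simp: p_def Gd1n_rels_def)
      then have "?eq (pos_word (i # p)) (pos_word [])" by (rule pres_eq.relation)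
      from pres_eq.append[OF pres_eq.refl this, of "[l]"] ib
      have "?eq ([l] @ pos_word (i # p)) [l]" by simp
      moreover have "?eq ([(i, False), (i, \<not> False)] @ pos_word p) ([] @ pos_word p)"
        by (intro pres_eq.append pres_eq.cancel pres_eq.refl) (use ib p in auto)
      ultimately have "?eq [l] (pos_word p)"
        using ib False by (auto intro: pres_eq.sym pres_eq.trans)
      then show ?thesis using p by blast
    qed
  qed
  have "\<exists>u \<in> lists {1..n}. ?eq w (pos_word u)" if "w \<in> lists ({1..n} \<times> UNIV)" for w
    using that
  proof (induction w)
    case Nil
    have "?eq [] (pos_word [])" by (simp add: pres_eq.refl)
    then show ?case by blast
  next
    case (Cons l w)
    then obtain u v where "u \<in> lists {1..n}" "?eq w (pos_word u)" "v \<in> lists {1..n}" "?eq [l] (pos_word v)"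
      using letter[of l] by auto
    then show ?case using pres_eq.append[of _ _ "[l]" "pos_word v" w "pos_word u"]
      by (intro bexI[of _ "v @ u"]) auto
  qed
  moreover obtain w where "w \<in> lists ({1..n} \<times> UNIV)" "g = pres_class {1..n} (Gd1n_rels d n) w"
    using assms by (auto simp: Gd1n_def presented_group_def)
  ultimately show ?thesis using that unfolding elt_def by (metis pres_class_eqI)
qed

end

section \<open>Full commutativity as a pattern condition\<close>

lemma commutation_append:
  assumes "(u, v) \<in> (commutation_step n)\<^sup>*"
  shows "(u @ w, v @ w) \<in> (commutation_step n)\<^sup>*"
  using assms
proof induction
  case (step y z)
  then obtain a b i j where "y = a @ [i, j] @ b" "z = a @ [j, i] @ b"
    "i \<in> {1..n} \<and> j \<in> {1..n} \<and> (j + 1 < i \<or> i + 1 < j)"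
    unfolding commutation_step_def by blast
  then have "y @ w = a @ [i, j] @ (b @ w)" "z @ w = a @ [j, i] @ (b @ w)"
    "i \<in> {1..n} \<and> j \<in> {1..n} \<and> (j + 1 < i \<or> i + 1 < j)" by auto
  then have "(y @ w, z @ w) \<in> commutation_step n"
    unfolding commutation_step_def by blast
  with step.IH show ?case by simp
qed simp

text \<open>
The invariant that separates minimal words whose last letters are \<open>i\<close> and \<open>i + 1\<close>.
\<close>

lemma commutation_filter:
  assumes "(u, v) \<in> (commutation_step n)\<^sup>*"
  shows "filter (\<lambda>a. a = i \<or> a = i + 1) u = filter (\<lambda>a. a = i \<or> a = i + 1) v"
  using assms
  by induction (auto simp: commutation_step_def)

text \<open>
Deleting the last occurrence of \<open>x\<close> from both words turns a commutation into a commutation or an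
equality.
\<close>

lemma commutation_cancel:
  assumes "(u @ [x], v @ [x]) \<in> (commutation_step n)\<^sup>*"
  shows "(u, v) \<in> (commutation_step n)\<^sup>*"
proof -
  define del where "del w = rev (remove1 x (rev w))" for w :: "nat list"
  have step: "(del y, del z) \<in> (commutation_step n)\<^sup>*" if "(y, z) \<in> commutation_step n" for y z
  proof -
    from that obtain a b i j where yz: "y = a @ [i, j] @ b" "z = a @ [j, i] @ b"
      "i \<in> {1..n} \<and> j \<in> {1..n} \<and> (j + 1 < i \<or> i + 1 < j)"
      unfolding commutation_step_def by blast
    have c: "(p @ [i, j] @ q, p @ [j, i] @ q) \<in> (commutation_step n)\<^sup>*" for p q
      using yz(3) unfolding commutation_step_def by blast
    consider "x \<in> set b" | "x \<notin> set b" "x = i \<or> x = j" | "x \<notin> set b" "x \<noteq> i" "x \<noteq> j" by blast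
    then show ?thesis
    proof cases
      case 1
      then have "del y = a @ [i, j] @ del b" "del z = a @ [j, i] @ del b"
        using yz by (simp_all add: del_def remove1_append)
      then show ?thesis using c by simp
    next
      case 2
      then have "del y = del z" using yz by (auto simp: del_def remove1_append)
      then show ?thesis by simp
    next
      case 3
      then have "del y = del a @ [i, j] @ b" "del z = del a @ [j, i] @ b"
        using yz by (auto simp: del_def remove1_append)
      then show ?thesis using c by simp
    qed
  qed
  have "(del (u @ [x]), del w) \<in> (commutation_step n)\<^sup>*" if "(u @ [x], w) \<in> (commutation_step n)\<^sup>*" for w
    using that by induction (auto intro: step rtrancl_trans)
  from this[OF assms] show ?thesis by (simp add: del_def)
qed

context coloured_words begin

definition comm_connected :: "cword \<Rightarrow> bool" where
  "comm_connected f \<longleftrightarrow> (\<forall>u \<in> reduced f. \<forall>v \<in> reduced f. (u, v) \<in> (commutation_step n)\<^sup>*)"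

lemma fc_word_low:
  assumes "state f" "i \<in> {1..n}" "right_descent i f" "fc_word f"
  shows "fc_word (low i f)"
proof (cases "i < n")
  case True
  then obtain as x y bs where "f = as @ x # y # bs" "length as = i - 1"
    using split_adjacent[OF state_length[OF assms(1)], of i] assms(2) by (metis atLeastAtMost_iff)
  then show ?thesis using assms fc_word_swap True by simp
next
  case False
  then have i: "i = n" using assms by simp
  obtain as w c where f: "f = as @ [(w, c)]" "length as = n - 1"
    using split_final state_length[OF assms(1)] by metis
  then show ?thesis using fc_word_lower[of as w c "c - 1"] assms i by simp
qed

lemma fc_word_descents_commute:
  assumes "state f" "fc_word f" "i \<in> {1..n}" "j \<in> {1..n}" "right_descent i f" "right_descent j f" "i < j"
  shows "i + 1 < j"
proof (rule ccontr)
  assume "\<not> i + 1 < j"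
  then have j: "j = i + 1" using assms(7) by simp
  then have "i < n" using assms(4) by simp
  then obtain as x y bs where f: "f = as @ x # y # bs" "length as = i - 1"
    using split_adjacent[OF state_length[OF assms(1)], of i] assms(3) by (metis atLeastAtMost_iff)
  have xy: "descent x y" using f assms \<open>i < n\<close> by simp
  have len: "length (as @ [x]) = j - 1" using f j assms(3) by simp
  show False
  proof (cases "j < n")
    case True
    then obtain z cs where bs: "bs = z # cs" using state_length[OF assms(1)] f j assms(3) by (cases bs) auto
    then have "descent y z" using assms(4,6) right_descent_swap[OF len, of y z cs] True f by simp
    then show False using fc_word_no_double_descent[OF xy] assms(2) f bs by simp
  next
    case False
    then have "j = n" using assms(4) by simp
    have "i - 1 + (length bs + 2) = n" "1 \<le> i" using state_length[OF assms(1)] f assms(3) by auto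
    then have "length bs = 0" using \<open>j = n\<close> j by linarith
    then have "bs = []" by simp
    moreover have "snd y \<noteq> 0" using assms(6) f \<open>bs = []\<close> \<open>j = n\<close> right_descent_last[of "as @ [x]" "fst y" "snd y"] len by simp
    ultimately show False using fc_word_no_final_descent[OF xy] assms(2) f by simp
  qed
qed

lemma comm_connected_aux:
  assumes IH: "\<And>g. wlen g < wlen f \<Longrightarrow> state g \<Longrightarrow> fc_word g \<Longrightarrow> comm_connected g"
    and f: "state f" "fc_word f" and i: "i \<in> {1..n}" "right_descent i f" and j: "j \<in> {1..n}" "right_descent j f"
    and u: "u \<in> reduced (low i f)" and v: "v \<in> reduced (low j f)" and ij: "i < j"
  shows "(u @ [i], v @ [j]) \<in> (commutation_step n)\<^sup>* \<and> (v @ [j], u @ [i]) \<in> (commutation_step n)\<^sup>*"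
proof -
  have far: "i + 1 < j" using fc_word_descents_commute[OF f i(1) j(1) i(2) j(2) ij] .
  then obtain t where t: "t @ [j] \<in> reduced (low i f)" "t @ [i] \<in> reduced (low j f)"
    using far_descents[OF f(1) i(1) j(1) _ i(2) j(2)] by blast
  have cI: "comm_connected (low i f)" and cJ: "comm_connected (low j f)"
    using IH[of "low i f"] IH[of "low j f"] wlen_low[OF f(1) i] wlen_low[OF f(1) j]
      low_state[OF f(1) i(1)] low_state[OF f(1) j(1)] fc_word_low[OF f(1) i f(2)] fc_word_low[OF f(1) j f(2)]
    by simp_all
  have sq: "(t @ [j, i] @ [], t @ [i, j] @ []) \<in> commutation_step n"
    "(t @ [i, j] @ [], t @ [j, i] @ []) \<in> commutation_step n"
    using i j far unfolding commutation_step_def by blast+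
  have "(u, t @ [j]) \<in> (commutation_step n)\<^sup>*" "(t @ [j], u) \<in> (commutation_step n)\<^sup>*"
    "(v, t @ [i]) \<in> (commutation_step n)\<^sup>*" "(t @ [i], v) \<in> (commutation_step n)\<^sup>*"
    using cI cJ t u v by (simp_all add: comm_connected_def)
  then have ends: "(u @ [i], t @ [j, i]) \<in> (commutation_step n)\<^sup>*" "(t @ [j, i], u @ [i]) \<in> (commutation_step n)\<^sup>*"
    "(v @ [j], t @ [i, j]) \<in> (commutation_step n)\<^sup>*" "(t @ [i, j], v @ [j]) \<in> (commutation_step n)\<^sup>*"
    using commutation_append[of u "t @ [j]" n "[i]"] commutation_append[of "t @ [j]" u n "[i]"]
      commutation_append[of v "t @ [i]" n "[j]"] commutation_append[of "t @ [i]" v n "[j]"] by simp_all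
  have mid: "(t @ [j, i], t @ [i, j]) \<in> (commutation_step n)\<^sup>*" "(t @ [i, j], t @ [j, i]) \<in> (commutation_step n)\<^sup>*"
    using sq by auto
  show ?thesis
    using rtrancl_trans[OF rtrancl_trans[OF ends(1) mid(1)] ends(4)]
      rtrancl_trans[OF rtrancl_trans[OF ends(3) mid(2)] ends(2)] ..
qed

text \<open>
Any two descents of a word that satisfies the pattern condition commute, so minimal words with
different last letters are connected through the commuting square of \<open>far_descents\<close>.
\<close>

lemma fc_word_comm_connected: "state f \<Longrightarrow> fc_word f \<Longrightarrow> comm_connected f"
proof (induction "wlen f" arbitrary: f rule: less_induct)
  case less
  show ?case unfolding comm_connected_def
  proof (intro ballI)
    fix u v assume uv: "u \<in> reduced f" "v \<in> reduced f"
    have len: "length u = wlen f" "length v = wlen f" using uv by (auto simp: reduced_def)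
    show "(u, v) \<in> (commutation_step n)\<^sup>*"
    proof (cases u rule: rev_cases)
      case Nil
      then show ?thesis using len by simp
    next
      case u: (snoc u' i)
      then obtain v' j where v: "v = v' @ [j]" using len by (cases v rule: rev_cases) auto
      have i: "i \<in> {1..n}" "right_descent i f" "u' \<in> reduced (low i f)" and j: "j \<in> {1..n}" "right_descent j f" "v' \<in> reduced (low j f)"
        using uv snoc_reduced[OF less.prems(1)] u v by auto
      consider "i = j" | "i < j" | "j < i" by linarith
      then show ?thesis
      proof cases
        case 1
        have "comm_connected (low i f)"
          using less.hyps[of "low i f"] wlen_low[OF less.prems(1) i(1,2)] low_state[OF less.prems(1) i(1)]
            fc_word_low[OF less.prems(1) i(1,2) less.prems(2)] by simp
        then show ?thesis using i j 1 u v commutation_append by (simp add: comm_connected_def)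
      next
        case 2
        then show ?thesis
          using comm_connected_aux[OF less.hyps less.prems i(1,2) j(1,2) i(3) j(3)] u v by simp
      next
        case 3
        then show ?thesis
          using comm_connected_aux[OF less.hyps less.prems j(1,2) i(1,2) j(3) i(3)] u v by simp
      qed
    qed
  qed
qed

text \<open>
A minimal word may end in either of the two letters, but commutations preserve which of them
comes last.
\<close>

lemma adjacent_not_connected:
  assumes f: "state f" and i: "i \<in> {1..n}" "right_descent i f" and j: "i + 1 \<in> {1..n}" "right_descent (i + 1) f"
  shows "\<not> comm_connected f"
proof
  assume c: "comm_connected f"
  obtain u v where u: "u \<in> reduced (low i f)" and v: "v \<in> reduced (low (i + 1) f)"
    using reduced_nonempty[OF low_state[OF f i(1)]] reduced_nonempty[OF low_state[OF f j(1)]] by blast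
  then have "u @ [i] \<in> reduced f" "v @ [i + 1] \<in> reduced f" using snoc_reduced[OF f] i j by blast+
  then have "(u @ [i], v @ [i + 1]) \<in> (commutation_step n)\<^sup>*" using c by (simp add: comm_connected_def)
  from commutation_filter[OF this, of i] show False by simp
qed

lemma low_not_connected:
  assumes f: "state f" and i: "i \<in> {1..n}" "right_descent i f" and low: "\<not> comm_connected (low i f)"
  shows "\<not> comm_connected f"
proof
  assume c: "comm_connected f"
  obtain u v where uv: "u \<in> reduced (low i f)" "v \<in> reduced (low i f)" "(u, v) \<notin> (commutation_step n)\<^sup>*"
    using low by (auto simp: comm_connected_def)
  then have "u @ [i] \<in> reduced f" "v @ [i] \<in> reduced f" using snoc_reduced[OF f] i by blast+
  then have "(u @ [i], v @ [i]) \<in> (commutation_step n)\<^sup>*" using c by (simp add: comm_connected_def)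
  then show False using commutation_cancel uv(3) by blast
qed

lemma not_fc_word_not_connected: "state f \<Longrightarrow> \<not> fc_word f \<Longrightarrow> \<not> comm_connected f"
proof (induction "wlen f" arbitrary: f rule: less_induct)
  case less
  have len: "length f = n" using state_length less.prems(1) .
  from not_fc_word_step[OF less.prems(2) state_distinct[OF less.prems(1)]]
  show ?case
  proof cases
    case (bad_step_triple as x y z bs)
    let ?i = "Suc (length as)"
    have "right_descent ?i f" "right_descent (?i + 1) f"
      using bad_step_triple len right_descent_swap[of as ?i x y "z # bs"] right_descent_swap[of "as @ [x]" "?i + 1" y z bs]
      by simp_all
    then show ?thesis using adjacent_not_connected[OF less.prems(1), of ?i] len bad_step_triple(1) by simp
  next
    case (bad_step_final as x y)
    let ?i = "Suc (length as)"
    have n: "n = ?i + 1" using bad_step_final len by simp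
    have "right_descent ?i f" using bad_step_final len right_descent_swap[of as ?i x y "[]"] by simp
    moreover have "right_descent (?i + 1) f"
      using bad_step_final n right_descent_last[of "as @ [x]" "fst y" "snd y"] by simp
    ultimately show ?thesis using adjacent_not_connected[OF less.prems(1), of ?i] n by simp
  next
    case (bad_step_swap as x y bs)
    let ?i = "Suc (length as)"
    have i: "?i \<in> {1..n}" "right_descent ?i f" and l: "low ?i f = as @ y # x # bs"
      using bad_step_swap len by simp_all
    then show ?thesis
      using low_not_connected[OF less.prems(1) i] less.hyps[of "low ?i f"] wlen_low[OF less.prems(1) i]
        low_state[OF less.prems(1) i(1)] bad_step_swap(3) by simp
  next
    case (bad_step_lower as w c)
    have i: "n \<in> {1..n}" "right_descent n f" and l: "low n f = as @ [(w, c)]"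
      using bad_step_lower len n3 by simp_all
    then show ?thesis
      using low_not_connected[OF less.prems(1) i] less.hyps[of "low n f"] wlen_low[OF less.prems(1) i]
        low_state[OF less.prems(1) i(1)] bad_step_lower(2) by simp
  qed
qed

theorem fully_commutative_iff:
  assumes "u \<in> lists {1..n}"
  shows "fully_commutative d n (E u) \<longleftrightarrow> fc_word (run u start)"
proof -
  have "fully_commutative d n (E u) \<longleftrightarrow> comm_connected (run u start)"
    by (simp add: fully_commutative_def comm_connected_def elt_carrier[OF assms] reduced_words_eq[OF assms])
  then show ?thesis
    using fc_word_comm_connected not_fc_word_not_connected state_run[OF assms state_start] by metis
qed

section \<open>The subgroup \<open>G(d,d,n)\<close>\<close>

abbreviation G :: "gelem monoid" where "G \<equiv> Gd1n d n"

lemma group_G: "group G"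
  by (simp add: Gd1n_def group_presented_group)

lemma one_G: "\<one>\<^bsub>G\<^esub> = E []"
  by (simp add: Gd1n_def presented_group_def elt_def)

lemma colour_sum:
  "u \<in> lists {1..n} \<Longrightarrow> sum_list (map snd (run u start)) mod d = count_list u n mod d"
proof (induction u rule: rev_induct)
  case Nil
  then show ?case by (simp add: start_def o_def)
next
  case (snoc i u)
  let ?g = "run u start"
  have g: "length ?g = n" using state_length state_run state_start snoc.prems by simp
  have i: "i \<in> {1..n}" using snoc.prems by simp
  show ?case
  proof (cases "i < n")
    case True
    then obtain as x y bs where "?g = as @ x # y # bs" "length as = i - 1"
      using split_adjacent[OF g, of i] i by (metis atLeastAtMost_iff)
    then show ?thesis using snoc True i by (simp add: sact_swap add.left_commute)
  next
    case False
    then have i: "i = n" using i by simp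
    obtain as w c where g': "?g = as @ [(w, c)]" "length as = n - 1"
      using split_final g by metis
    then have "(sum_list (map snd as) + c) mod d = count_list u n mod d" using snoc by simp
    then have "(sum_list (map snd as) + (c + 1) mod d) mod d = (count_list u n + 1) mod d"
      by (metis add.assoc mod_add_left_eq mod_add_right_eq)
    then show ?thesis using g' i by (simp add: sact_last)
  qed
qed

definition inverse_word :: "nat list \<Rightarrow> nat list" where
  "inverse_word u = concat (map (\<lambda>i. if i < n then [i] else replicate (d - 1) n) (rev u))"

lemma inverse_word_Cons:
  "inverse_word (i # u) = inverse_word u @ (if i < n then [i] else replicate (d - 1) n)"
  by (simp add: inverse_word_def)

lemma inverse_word_lists: "u \<in> lists {1..n} \<Longrightarrow> inverse_word u \<in> lists {1..n}"
proof (induction u)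
  case Nil
  then show ?case by (simp add: inverse_word_def)
next
  case (Cons i u)
  then show ?case unfolding inverse_word_Cons using n3 by auto
qed

lemma count_inverse_word: "u \<in> lists {1..n} \<Longrightarrow> count_list (inverse_word u) n = (d - 1) * count_list u n"
proof (induction u)
  case Nil
  then show ?case by (simp add: inverse_word_def)
next
  case (Cons i u)
  then have "count_list (inverse_word u) n = (d - 1) * count_list u n" "i \<in> {1..n}" by auto
  then show ?case unfolding inverse_word_Cons
    by (auto simp: count_list_eq_length_filter)
qed

lemma E_inverse_word: "u \<in> lists {1..n} \<Longrightarrow> E (u @ inverse_word u) = E []"
proof (induction u rule: rev_induct)
  case Nil
  then show ?case by (simp add: inverse_word_def)
next
  case (snoc i u)
  have u: "u \<in> lists {1..n}" "inverse_word u \<in> lists {1..n}" and i: "i \<in> {1..n}"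
    using snoc.prems inverse_word_lists by auto
  let ?p = "if i < n then [i] else replicate (d - 1) n"
  have "(i # ?p, []) \<in> Gd1n_rels d n"
    using i d2 by (cases d) (auto simp: Gd1n_rels_def)
  from elt_relation[OF this u] have "E (u @ (i # ?p) @ inverse_word u) = E (u @ inverse_word u)" by simp
  then show ?case using snoc u by (simp add: inverse_word_def)
qed

lemma inv_E: assumes "u \<in> lists {1..n}" shows "inv\<^bsub>G\<^esub> (E u) = E (inverse_word u)"
proof -
  interpret group G by (rule group_G)
  have "E u \<otimes>\<^bsub>G\<^esub> E (inverse_word u) = \<one>\<^bsub>G\<^esub>"
    using E_inverse_word elt_append inverse_word_lists assms one_G by simp
  then show ?thesis
    using assms inverse_word_lists elt_carrier by (metis inv_equality inv_inv inv_closed r_inv l_inv inv_comm)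
qed

lemma Gddn_count:
  assumes "g \<in> Gddn d n"
  shows "\<exists>u \<in> lists {1..n}. g = E u \<and> d dvd count_list u n"
proof -
  have gen: "\<exists>u \<in> lists {1..n}. h = E u \<and> d dvd count_list u n"
    if "h \<in> {E [i] | i. 1 \<le> i \<and> i \<le> n - 1} \<union> {E (replicate (d - 1) n @ [n - 1, n])}" for h
    using that
  proof (elim UnE)
    assume "h \<in> {E [i] | i. 1 \<le> i \<and> i \<le> n - 1}"
    then obtain i where "h = E [i]" "1 \<le> i" "i \<le> n - 1" by blast
    then show ?thesis using n3 by (intro bexI[of _ "[i]"]) auto
  next
    assume "h \<in> {E (replicate (d - 1) n @ [n - 1, n])}"
    moreover have "count_list (replicate (d - 1) n @ [n - 1, n]) n = d"
      using d2 n3 by (simp add: count_list_eq_length_filter)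
    ultimately show ?thesis using n3 by (intro bexI[of _ "replicate (d - 1) n @ [n - 1, n]"]) auto
  qed
  show ?thesis using assms unfolding Gddn_def
  proof (induction rule: generate.induct)
    case one
    then show ?case using one_G by (intro bexI[of _ "[]"]) auto
  next
    case (incl h)
    then show ?case by (rule gen)
  next
    case (inv h)
    then obtain u where "u \<in> lists {1..n}" "h = E u" "d dvd count_list u n" using gen by blast
    then show ?case using inv_E inverse_word_lists count_inverse_word
      by (intro bexI[of _ "inverse_word u"]) auto
  next
    case (eng h1 h2)
    then obtain u v where "u \<in> lists {1..n}" "h1 = E u" "d dvd count_list u n"
      "v \<in> lists {1..n}" "h2 = E v" "d dvd count_list v n" by blast
    then show ?case using elt_append by (intro bexI[of _ "u @ v"]) auto
  qed
qed

lemma run_turn: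
  assumes "length as = n - 2" "a < d" "c < d"
  shows "run (replicate p n @ [n - 1] @ replicate q n) (as @ [(v, a), (w, c)])
    = as @ [(w, (c + p) mod d), (v, (a + q) mod d)]"
proof -
  have l: "length (as @ [x]) = n - 1" "length as = n - 1 - 1" "1 \<le> n - 1" "n - 1 < n" for x
    using assms n3 by auto
  have 1: "run (replicate k n) (as @ [x, (y, e)]) = as @ [x, (y, (e + k) mod d)]" if "e < d" for x y e k
    using run_replicate[OF l(1)[of x] that, of k y] by simp
  have 2: "act (n - 1) (as @ [x, y]) = as @ [y, x]" for x y
    using sact_swap[OF l(2-4), of True x y "[]"] by simp
  show ?thesis using 1 2 assms by simp
qed

text \<open>
A way to verify identities between words in \<open>s_{n-1}\<close> and \<open>s_n\<close>, which only affect the last two entries.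
\<close>

lemma E_eqI:
  assumes "u \<in> lists {1..n}" "v \<in> lists {1..n}"
    "\<And>as a c v' w. length as = n - 2 \<Longrightarrow> a < d \<Longrightarrow> c < d \<Longrightarrow>
       run u (as @ [(v', a), (w, c)]) = run v (as @ [(v', a), (w, c)])"
  shows "E u = E v"
proof -
  obtain as x y where s: "start = as @ [x, y]" "length as = n - 2"
  proof -
    have "length start = n" by (simp add: start_def)
    then obtain bs y where b: "start = bs @ [y]" "length bs = n - 1" using split_final by metis
    moreover obtain as x where "bs = as @ [x]" using b n3 by (cases bs rule: rev_cases) auto
    ultimately show ?thesis using that[of as x y] by simp
  qed
  have "snd x < d" "snd y < d" using state_start s by (auto simp: state_def)
  then have "run u start = run v start"
    using assms(3)[of as "snd x" "snd y" "fst x" "fst y"] s by simp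
  then show ?thesis using elt_eq_iff assms by blast
qed

text \<open>
The conjugate \<open>s_n^{-k} s_{n-1} s_n^k\<close>, where \<open>s_n^{-1}\<close> is written as \<open>s_n^(d-1)\<close>. For \<open>k = 0\<close> and \<open>k = 1\<close>
these are generators of \<open>G(d,d,n)\<close>.
\<close>

definition conjugate_word :: "nat \<Rightarrow> nat list" where
  "conjugate_word k = replicate ((d - 1) * k) n @ [n - 1] @ replicate k n"

lemma conjugate_word_lists: "conjugate_word k \<in> lists {1..n}"
  using n3 by (auto simp: conjugate_word_def)

lemma run_conjugate_word:
  assumes "length as = n - 2" "a < d" "c < d"
  shows "run (conjugate_word k) (as @ [(v, a), (w, c)]) = as @ [(w, (c + (d - 1) * k) mod d), (v, (a + k) mod d)]"
  unfolding conjugate_word_def using run_turn[OF assms] .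

text \<open>
Consecutive conjugates generate the next one, so all of them lie in \<open>G(d,d,n)\<close>. For \<open>k = 0\<close> the
identity is a rearrangement of the relation of length four.
\<close>

lemma E_conjugate_step: "E (conjugate_word (k + 2)) = E (conjugate_word (k + 1) @ conjugate_word k @ conjugate_word (k + 1))"
proof (rule E_eqI)
  fix as :: cword and a c v w assume as: "length as = n - 2" and ac: "a < d" "c < d"
  obtain e where d: "d = Suc e" using d2 by (cases d) auto
  have "e * (k + 1) + k + e * (k + 1) = e * (k + 2) + d * k" using d by (simp add: algebra_simps)
  then have "(c + e * (k + 1) + k + e * (k + 1)) mod d = (c + e * (k + 2)) mod d"
    by (metis add.assoc mod_mult_self2)
  moreover have "k + 1 + e * k + (k + 1) = k + 2 + d * k" using d by (simp add: algebra_simps)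
  then have "(a + (k + 1) + e * k + (k + 1)) mod d = (a + (k + 2)) mod d"
    by (metis add.assoc mod_mult_self2)
  ultimately show "run (conjugate_word (k + 2)) (as @ [(v, a), (w, c)])
      = run (conjugate_word (k + 1) @ conjugate_word k @ conjugate_word (k + 1)) (as @ [(v, a), (w, c)])"
    using run_conjugate_word[OF as] ac d by (simp add: mod_add_left_eq del: add_Suc add_Suc_right One_nat_def add_2_eq_Suc add_2_eq_Suc')
qed (use conjugate_word_lists in \<open>simp_all del: in_lists_conv_set\<close>)

lemma subgroup_Gddn: "subgroup (Gddn d n) G"
proof -
  interpret group G by (rule group_G)
  have "{E [i] | i. 1 \<le> i \<and> i \<le> n - 1} \<union> {E (replicate (d - 1) n @ [n - 1, n])} \<subseteq> carrier G"
    using n3 by (auto intro!: elt_carrier)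
  then show ?thesis unfolding Gddn_def by (rule generate_is_subgroup)
qed

lemma E_conjugate_Gddn: "E (conjugate_word k) \<in> Gddn d n"
proof (induction k rule: less_induct)
  case (less k)
  consider "k = 0" | "k = 1" | m where "k = m + 2"
    by (metis One_nat_def Suc_1 add.commute add_2_eq_Suc not0_implies_Suc)
  then show ?case
  proof cases
    case 1
    then have "E (conjugate_word k) \<in> {E [i] | i. 1 \<le> i \<and> i \<le> n - 1}" using n3 by (auto simp: conjugate_word_def)
    then show ?thesis unfolding Gddn_def by (intro generate.incl) blast
  next
    case 2
    then show ?thesis unfolding Gddn_def by (intro generate.incl) (simp add: conjugate_word_def)
  next
    case 3
    have "E (conjugate_word (m + 1)) \<in> Gddn d n" "E (conjugate_word m) \<in> Gddn d n" using less 3 by auto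
    moreover have "E (conjugate_word k) = E (conjugate_word (m + 1)) \<otimes>\<^bsub>G\<^esub> (E (conjugate_word m) \<otimes>\<^bsub>G\<^esub> E (conjugate_word (m + 1)))"
      unfolding 3 E_conjugate_step
      using elt_append[OF conjugate_word_lists, of "conjugate_word m @ conjugate_word (m + 1)" "m + 1"] elt_append[OF conjugate_word_lists conjugate_word_lists, of m "m + 1"]
        conjugate_word_lists[of m] conjugate_word_lists[of "m + 1"] by (simp del: in_lists_conv_set)
    ultimately show ?thesis using subgroup.m_closed[OF subgroup_Gddn] by simp
  qed
qed

text \<open>
The powers of \<open>s_n\<close> represent all cosets of \<open>G(d,d,n)\<close>: move them to the right through each new letter,
which is thereby replaced by a conjugate that lies in the subgroup.
\<close>

lemma Gddn_coset:
  "u \<in> lists {1..n} \<Longrightarrow> \<exists>h \<in> Gddn d n. E u = h \<otimes>\<^bsub>G\<^esub> E (replicate (count_list u n) n)"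
proof (induction u rule: rev_induct)
  case Nil
  interpret group G by (rule group_G)
  have "\<one>\<^bsub>G\<^esub> \<in> Gddn d n" using subgroup.one_closed[OF subgroup_Gddn] .
  moreover have "E [] = \<one>\<^bsub>G\<^esub> \<otimes>\<^bsub>G\<^esub> E (replicate (count_list [] n) n)"
    using l_one[OF one_closed] unfolding one_G by simp
  ultimately show ?case by blast
next
  case (snoc i u)
  interpret group G by (rule group_G)
  let ?m = "count_list u n"
  obtain h where h: "h \<in> Gddn d n" "E u = h \<otimes>\<^bsub>G\<^esub> E (replicate ?m n)" using snoc by auto
  have hc: "h \<in> carrier G" using h subgroup.subset[OF subgroup_Gddn] by blast
  have i: "i \<in> {1..n}" and u: "u \<in> lists {1..n}" using snoc.prems by auto
  have r: "replicate k n \<in> lists {1..n}" for k using n3 by auto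
  have Eu: "E (u @ [i]) = h \<otimes>\<^bsub>G\<^esub> E (replicate ?m n @ [i])"
    using h(2) elt_append[OF u, of "[i]"] elt_append[OF r, of "[i]" ?m] i hc elt_carrier[OF r] elt_carrier[of "[i]"]
    by (simp add: m_assoc)
  have step: ?case if x: "x \<in> lists {1..n}" "E x \<in> Gddn d n" and "i \<noteq> n"
     "E (replicate ?m n @ [i]) = E (x @ replicate ?m n)" for x
  proof (intro bexI)
    show "h \<otimes>\<^bsub>G\<^esub> E x \<in> Gddn d n" using subgroup.m_closed[OF subgroup_Gddn h(1) x(2)] .
    show "E (u @ [i]) = h \<otimes>\<^bsub>G\<^esub> E x \<otimes>\<^bsub>G\<^esub> E (replicate (count_list (u @ [i]) n) n)"
      using Eu that elt_append[OF x(1) r] hc elt_carrier[OF x(1)] elt_carrier[OF r] by (simp add: m_assoc)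
  qed
  consider "i = n" | "i = n - 1" "i \<noteq> n" | "i + 1 < n" using i by fastforce
  then show ?case
  proof cases
    case 1
    then show ?thesis using h Eu by (intro bexI[of _ h]) (simp_all add: replicate_append_same)
  next
    case 2
    obtain e where d: "d = Suc e" using d2 by (cases d) auto
    show ?thesis
    proof (rule step[OF conjugate_word_lists E_conjugate_Gddn 2(2)])
      \<comment> \<open>Conjugation by \<open>s_n^m\<close> is wanted, and \<open>e = d - 1\<close> is \<open>-1\<close> modulo \<open>d\<close>.\<close>
      show "E (replicate ?m n @ [i]) = E (conjugate_word (e * ?m) @ replicate ?m n)"
      proof (rule E_eqI)
        fix as :: cword and a c v w assume as: "length as = n - 2" and ac: "a < d" "c < d"
        have l: "length (as @ [x]) = n - 1" for x using as n3 by simp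
        have "e * (e * ?m) + d * ?m = ?m + d * (e * ?m)" using d by (simp add: algebra_simps)
        then have "(c + e * (e * ?m)) mod d = (c + ?m) mod d"
          by (metis add.assoc mod_mult_self2)
        moreover have "a + e * ?m + ?m = a + d * ?m" using d by (simp add: algebra_simps)
        then have "(a + e * ?m + ?m) mod d = a" using ac by (metis mod_mult_self2 mod_less)
        then have "((a + e * ?m) mod d + ?m) mod d = a" by (simp only: mod_add_left_eq)
        moreover have "run (replicate ?m n @ [i]) (as @ [(v, a), (w, c)]) = as @ [(w, (c + ?m) mod d), (v, a)]"
          using run_turn[OF as ac, of ?m 0] 2 ac by simp
        moreover have "run (replicate ?m n) (as @ [y, (v, e')]) = as @ [y, (v, (e' + ?m) mod d)]" if "e' < d" for y e'
          using run_replicate[OF l that] by simp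
        ultimately show "run (replicate ?m n @ [i]) (as @ [(v, a), (w, c)])
            = run (conjugate_word (e * ?m) @ replicate ?m n) (as @ [(v, a), (w, c)])"
          using run_conjugate_word[OF as ac] d by simp
      qed (use conjugate_word_lists i n3 in auto)
    qed
  next
    case 3
    show ?thesis
    proof (rule step[of "[i]"])
      have "E [i] \<in> {E [i] | i. 1 \<le> i \<and> i \<le> n - 1}" using 3 i by fastforce
      then show "E [i] \<in> Gddn d n" unfolding Gddn_def by (intro generate.incl) blast
      have "([n, i], [i, n]) \<in> Gd1n_rels d n" using 3 i by (auto simp: Gd1n_rels_def)
      then have c: "E (a @ [n, i] @ b) = E (a @ [i, n] @ b)" if "a \<in> lists {1..n}" "b \<in> lists {1..n}" for a b
        using that by (rule elt_relation)
      have "E (replicate m n @ [i]) = E ([i] @ replicate m n)" for m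
      proof (induction m)
        case (Suc m)
        have "E (replicate (Suc m) n @ [i]) = E (replicate m n @ [n, i] @ [])"
          by (simp add: replicate_app_Cons_same)
        also have "\<dots> = E (replicate m n @ [i, n] @ [])"
          by (rule c) (use r[of m] in simp_all)
        also have "\<dots> = E ([] @ (replicate m n @ [i]) @ [n])" by simp
        also have "\<dots> = E ([] @ ([i] @ replicate m n) @ [n])"
          by (rule elt_cong[OF Suc.IH]) (use i n3 r[of m] in auto)
        also have "\<dots> = E ([i] @ replicate (Suc m) n)" by (simp add: replicate_append_same)
        finally show ?case .
      qed simp
      then show "E (replicate ?m n @ [i]) = E ([i] @ replicate ?m n)" .
    qed (use i 3 in auto)
  qed
qed

theorem Gddn_iff:
  assumes "u \<in> lists {1..n}"
  shows "E u \<in> Gddn d n \<longleftrightarrow> d dvd count_list u n"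
proof
  assume "E u \<in> Gddn d n"
  then obtain v where v: "v \<in> lists {1..n}" "E u = E v" "d dvd count_list v n" using Gddn_count by blast
  then have "run u start = run v start" using elt_eq_iff assms by blast
  then show "d dvd count_list u n" using colour_sum[OF assms] colour_sum[OF v(1)] v(3)
    by (metis mod_eq_0_iff_dvd)
next
  assume "d dvd count_list u n"
  then obtain k where k: "count_list u n = d * k" by blast
  interpret group G by (rule group_G)
  have r: "replicate k n \<in> lists {1..n}" for k using n3 by auto
  have "E (replicate (d * k) n) = E []" for k
  proof (induction k)
    case (Suc k)
    have "E ([] @ replicate d n @ replicate (d * k) n) = E ([] @ replicate (d * k) n)"
      by (rule E_power) (use r in simp_all)
    then show ?case using Suc by (simp add: replicate_add)
  qed simp
  moreover obtain h where h: "h \<in> Gddn d n" "E u = h \<otimes>\<^bsub>G\<^esub> E (replicate (d * k) n)"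
    using Gddn_coset[OF assms] k by auto
  moreover have "h \<in> carrier G" using h subgroup.subset[OF subgroup_Gddn] by blast
  ultimately show "E u \<in> Gddn d n" using one_G by (metis r_one)
qed

end

section \<open>Colour sequences\<close>

text \<open>
The inverse of flattening for a prescribed sequence of colours.
\<close>

fun place :: "nat list \<Rightarrow> nat list \<Rightarrow> cword" where
  "place [] p = []"
| "place (c # cs) p = (if c = 0 then (hd p, 0) # place cs (tl p) else (last p, c) # place cs (butlast p))"

lemma flat_place: "length p = length cs \<Longrightarrow> flat (place cs p) = p"
proof (induction cs arbitrary: p)
  case (Cons c cs)
  then have "p \<noteq> []" by auto
  then show ?case using Cons by simp
qed simp

lemma colours_place: "map snd (place cs p) = cs"
  by (induction cs arbitrary: p) auto

lemma flat_inject: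
  "map snd f = map snd g \<Longrightarrow> flat f = flat g \<Longrightarrow> f = g"
proof (induction f arbitrary: g)
  case (Cons x f)
  then obtain y g' where "g = y # g'" by (cases g) auto
  then show ?case using Cons by (auto simp: prod_eq_iff split: if_splits)
qed simp

lemma perm_list_flat: "perm_list m (flat f) \<longleftrightarrow> perm_list m (map fst f)"
  using mset_flat[of f] unfolding perm_list_def by (metis mset_eq_imp_distinct_iff mset_eq_setD)

lemma tail_sorted_iff:
  assumes "map snd f = replicate k 0 @ t # cs" "t \<noteq> 0" "\<exists>c \<in> set cs. c \<noteq> 0"
  shows "tail_sorted f \<longleftrightarrow> sorted (drop k (flat f))"
  using assms(1)
proof (induction k arbitrary: f)
  case 0
  then obtain x f' where f: "f = x # f'" "snd x = t" "map snd f' = cs" by (cases f) auto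
  then have "coloured f'" using assms(3) by (auto simp: coloured_def)
  then show ?case using f assms(2) by (auto simp: sorted_append)
next
  case (Suc k)
  then obtain x f' where "f = x # f'" by (cases f) auto
  then show ?case using Suc by simp
qed

lemma tail_sorted_uncoloured: "\<not> coloured f \<Longrightarrow> tail_sorted f"
  by (induction f) auto

lemma tail_sorted_sorted: "sorted (flat f) \<Longrightarrow> tail_sorted f"
  by (induction f) (auto simp: sorted_append)

fun data_of :: "nat \<Rightarrow> nat list \<Rightarrow> (nat \<times> nat) list" where
  "data_of m [] = []"
| "data_of m (c # cs) = (if c = 0 then data_of (Suc m) cs else (c, m) # data_of (Suc m) cs)"

lemma data_of_zeros: "data_of m (replicate k 0 @ cs) = data_of (m + k) cs"
  by (induction k arbitrary: m) auto

lemma data_of_eq_Nil: "data_of m cs = [] \<longleftrightarrow> (\<forall>c \<in> set cs. c = 0)"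
  by (induction cs arbitrary: m) auto

lemma data_of_bounds: "(k, j) \<in> set (data_of m cs) \<Longrightarrow> k \<in> set cs \<and> 1 \<le> k \<and> m \<le> j \<and> j < m + length cs"
  by (induction cs arbitrary: m) (fastforce split: if_splits)+

lemma data_of_sorted: "sorted_wrt (<) (map snd (data_of m cs))"
  by (induction cs arbitrary: m) (auto dest!: data_of_bounds)

context coloured_words begin

definition colour_lists :: "nat \<Rightarrow> nat list set" where
  "colour_lists m = {cs. set cs \<subseteq> {..<d} \<and> length cs = m}"

lemma finite_colour_lists: "finite (colour_lists m)"
  unfolding colour_lists_def by (rule finite_lists_length_eq) simp

lemma card_colour_lists: "card (colour_lists m) = d ^ m"
  unfolding colour_lists_def by (subst card_lists_length_eq) simp_all

text \<open>
The unique colour which, put in front of \<open>cs\<close>, makes the sum divisible by \<open>d\<close>.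
\<close>

definition complement :: "nat list \<Rightarrow> nat" where
  "complement cs = (d - sum_list cs mod d) mod d"

lemma complement_less: "complement cs < d"
  using d2 by (simp add: complement_def)

lemma complement_iff: "t < d \<Longrightarrow> d dvd t + sum_list cs \<longleftrightarrow> t = complement cs"
proof -
  assume t: "t < d"
  define s where "s = sum_list cs mod d"
  have s: "s < d" using d2 by (simp add: s_def)
  have "d dvd t + sum_list cs \<longleftrightarrow> (t + s) mod d = 0"
    unfolding s_def by (simp add: mod_add_right_eq dvd_eq_mod_eq_0)
  also have "\<dots> \<longleftrightarrow> t + s = 0 \<or> t + s = d"
  proof
    assume a: "(t + s) mod d = 0"
    show "t + s = 0 \<or> t + s = d"
    proof (cases "t + s < d")
      case True
      then show ?thesis using a by simp
    next
      case False
      then have "(t + s) mod d = t + s - d" using t s by (simp add: mod_if)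
      then show ?thesis using a False by simp
    qed
  qed auto
  also have "\<dots> \<longleftrightarrow> t = (d - s) mod d"
    using t s by (cases "s = 0") auto
  finally show ?thesis by (simp add: complement_def s_def)
qed

lemma complement_eq_0: "complement cs = 0 \<longleftrightarrow> d dvd sum_list cs"
  using complement_iff[of 0 cs] d2 by auto

lemma card_zero_sum: "card {cs \<in> colour_lists (Suc m). d dvd sum_list cs} = d ^ m"
proof -
  have "{cs \<in> colour_lists (Suc m). d dvd sum_list cs} = (\<lambda>cs. complement cs # cs) ` colour_lists m"
  proof (intro equalityI subsetI)
    fix cs assume a: "cs \<in> {cs \<in> colour_lists (Suc m). d dvd sum_list cs}"
    then obtain c cs' where cs: "cs = c # cs'" by (cases cs) (auto simp: colour_lists_def)
    then have "c = complement cs'" using a complement_iff by (auto simp: colour_lists_def)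
    then show "cs \<in> (\<lambda>cs. complement cs # cs) ` colour_lists m"
      using a cs by (auto simp: colour_lists_def)
  next
    fix cs assume "cs \<in> (\<lambda>cs. complement cs # cs) ` colour_lists m"
    then show "cs \<in> {cs \<in> colour_lists (Suc m). d dvd sum_list cs}"
      using complement_less complement_iff by (auto simp: colour_lists_def)
  qed
  moreover have "inj_on (\<lambda>cs. complement cs # cs) (colour_lists m)" by (auto intro: inj_onI)
  ultimately show ?thesis using card_image card_colour_lists by metis
qed

text \<open>
The colour sequences of elements of \<open>G(d,d,n)\<close> whose first coloured entry is preceded by exactly \<open>k\<close>
entries.
\<close>

definition zero_sum_at :: "nat \<Rightarrow> nat list set" where
  "zero_sum_at k = {cs \<in> colour_lists n. d dvd sum_list cs \<and> (\<exists>t cs'. t \<noteq> 0 \<and> cs = replicate k 0 @ t # cs')}"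

text \<open>
A single non-zero colour cannot have sum zero modulo \<open>d\<close>, so a second one must follow. This is why
collections labelled by \<open>s_n^t s_{n-1} \<dots> s_k\<close> do not occur in \<open>G(d,d,n)\<close>.
\<close>

lemma zero_sum_atE:
  assumes "cs \<in> zero_sum_at k"
  obtains t cs' where "cs = replicate k 0 @ t # cs'" "0 < t" "t < d" "length cs' = n - k - 1" "set cs' \<subseteq> {..<d}"
    "d dvd t + sum_list cs'" "\<exists>c \<in> set cs'. c \<noteq> 0" "k + 2 \<le> n"
proof -
  obtain t cs' where cs: "cs = replicate k 0 @ t # cs'" "t \<noteq> 0" and d: "d dvd sum_list cs" "cs \<in> colour_lists n"
    using assms by (auto simp: zero_sum_at_def)
  have *: "d dvd t + sum_list cs'" "t < d" using d cs by (auto simp: colour_lists_def sum_list_replicate)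
  have nz: "\<exists>c \<in> set cs'. c \<noteq> 0"
  proof (rule ccontr)
    assume "\<not> ?thesis"
    then have "sum_list cs' = 0" by auto
    then have "d dvd t" using *(1) by (metis add_0_right)
    then show False using *(2) cs(2) by (auto dest: dvd_imp_le)
  qed
  then have "0 < length cs'" by auto
  moreover have "n = k + 1 + length cs'" using d(2) cs(1) by (simp add: colour_lists_def)
  ultimately have "length cs' = n - k - 1" "k + 2 \<le> n" by linarith+
  moreover have "set cs' \<subseteq> {..<d}" using d(2) cs(1) by (simp add: colour_lists_def)
  ultimately show ?thesis using that[OF cs(1)] cs(2) * nz by blast
qed

text \<open>
The colours behind the first non-zero one determine it, and may be arbitrary as long as their own sum
is not divisible by \<open>d\<close>.
\<close>

lemma card_zero_sum_at:
  assumes "k + 2 \<le> n"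
  shows "card (zero_sum_at k) = (d - 1) * d ^ (n - 2 - k)"
proof -
  obtain r where r: "n = k + Suc (Suc r)" using assms by (metis add.commute add_2_eq_Suc le_Suc_ex add.assoc)
  let ?A = "{cs \<in> colour_lists (Suc r). d dvd sum_list cs}" and ?h = "\<lambda>cs. replicate k 0 @ complement cs # cs"
  have "zero_sum_at k = ?h ` (colour_lists (Suc r) - ?A)"
  proof (intro equalityI subsetI)
    fix cs assume "cs \<in> zero_sum_at k"
    then obtain t cs' where *: "cs = replicate k 0 @ t # cs'" "0 < t" "t < d" "length cs' = n - k - 1" "set cs' \<subseteq> {..<d}"
      "d dvd t + sum_list cs'" by (rule zero_sum_atE)
    then have "t = complement cs'" using complement_iff by simp
    then show "cs \<in> ?h ` (colour_lists (Suc r) - ?A)" using * r complement_eq_0[of cs']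
      by (intro image_eqI[of _ _ cs']) (auto simp: colour_lists_def)
  next
    fix cs assume "cs \<in> ?h ` (colour_lists (Suc r) - ?A)"
    then obtain cs' where cs: "cs = ?h cs'" "cs' \<in> colour_lists (Suc r)" "\<not> d dvd sum_list cs'" by auto
    then have "complement cs' \<noteq> 0" using complement_eq_0 by simp
    moreover have "d dvd sum_list cs" "cs \<in> colour_lists n"
      using cs complement_less[of cs'] complement_iff[of "complement cs'" cs'] d2 r
      by (auto simp: colour_lists_def sum_list_replicate)
    ultimately show "cs \<in> zero_sum_at k" using cs(1) by (auto simp: zero_sum_at_def)
  qed
  moreover have "inj_on ?h (colour_lists (Suc r) - ?A)" by (auto intro: inj_onI)
  ultimately have "card (zero_sum_at k) = card (colour_lists (Suc r) - ?A)" by (simp add: card_image)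
  also have "\<dots> = card (colour_lists (Suc r)) - card ?A"
    by (rule card_Diff_subset) (auto intro: finite_subset[OF _ finite_colour_lists])
  also have "\<dots> = (d - 1) * d ^ r" by (simp add: card_zero_sum card_colour_lists algebra_simps)
  finally show ?thesis using r by simp
qed

lemma zero_sum_partition:
  "{cs \<in> colour_lists n. d dvd sum_list cs} = insert (replicate n 0) (\<Union>k\<in>{0..n - 2}. zero_sum_at k)"
proof (intro equalityI subsetI)
  fix cs assume a: "cs \<in> {cs \<in> colour_lists n. d dvd sum_list cs}"
  show "cs \<in> insert (replicate n 0) (\<Union>k\<in>{0..n - 2}. zero_sum_at k)"
  proof (cases "\<exists>c \<in> set cs. c \<noteq> 0")
    case True
    then obtain zs t cs' where cs: "cs = zs @ t # cs'" "t \<noteq> 0" "\<forall>z \<in> set zs. z = 0"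
      using split_list_first_prop[of cs "\<lambda>c. c \<noteq> 0"] by auto
    then have "zs = replicate (length zs) 0" by (simp add: replicate_eqI)
    then have z: "cs \<in> zero_sum_at (length zs)" using a cs unfolding zero_sum_at_def by auto
    then have "length zs + 2 \<le> n" by (rule zero_sum_atE)
    then show ?thesis using z by auto
  next
    case False
    then have "cs = replicate n 0" using a by (auto simp: colour_lists_def intro!: replicate_eqI)
    then show ?thesis by simp
  qed
next
  fix cs assume "cs \<in> insert (replicate n 0) (\<Union>k\<in>{0..n - 2}. zero_sum_at k)"
  then show "cs \<in> {cs \<in> colour_lists n. d dvd sum_list cs}"
    using d2 by (auto simp: zero_sum_at_def colour_lists_def sum_list_replicate)
qed

lemma zero_sum_at_disjoint: "cs \<in> zero_sum_at k \<Longrightarrow> cs \<in> zero_sum_at k' \<Longrightarrow> k = k'"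
proof -
  have first: "length (takeWhile (\<lambda>c. c = 0) cs) = k" if "cs \<in> zero_sum_at k" for k
    using that by (auto simp: zero_sum_at_def takeWhile_append)
  then show "cs \<in> zero_sum_at k \<Longrightarrow> cs \<in> zero_sum_at k' \<Longrightarrow> k = k'" by blast
qed

section \<open>Counting fully commutative elements\<close>

definition fc_states :: "nat list \<Rightarrow> cword set" where
  "fc_states cs = {f. state f \<and> map snd f = cs \<and> fc_word f}"

text \<open>
For a fixed colour sequence, coloured words correspond to their prefixes.
\<close>

lemma card_fc_states:
  assumes cs: "cs \<in> colour_lists n"
    and k: "\<And>f. map snd f = cs \<Longrightarrow> tail_sorted f \<longleftrightarrow> sorted (drop k (flat f))"
  shows "card (fc_states cs) = card (ballot_perms n k)"
proof -
  have "flat ` fc_states cs = ballot_perms n k"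
  proof (intro equalityI subsetI)
    fix p assume "p \<in> flat ` fc_states cs"
    then show "p \<in> ballot_perms n k"
      using k by (auto simp: fc_states_def fc_word_def ballot_perms_def state_def perm_list_flat)
  next
    fix p assume p: "p \<in> ballot_perms n k"
    then have "length p = n" using perm_length by (auto simp: ballot_perms_def)
    then have fl: "flat (place cs p) = p" using flat_place cs by (simp add: colour_lists_def)
    have "perm_list n (map fst (place cs p))"
      using p perm_list_flat[of n "place cs p"] fl by (simp add: ballot_perms_def)
    moreover have "\<forall>x \<in> set (place cs p). snd x < d"
    proof
      fix x assume "x \<in> set (place cs p)"
      then have "snd x \<in> set (map snd (place cs p))" by simp
      then have "snd x \<in> set cs" unfolding colours_place .
      then show "snd x < d" using cs by (auto simp: colour_lists_def)
    qed
    ultimately have "place cs p \<in> fc_states cs"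
      using p k[OF colours_place] fl by (simp add: fc_states_def fc_word_def ballot_perms_def state_def colours_place)
    then show "p \<in> flat ` fc_states cs" using fl by force
  qed
  moreover have "inj_on flat (fc_states cs)"
    using flat_inject by (auto intro!: inj_onI simp: fc_states_def)
  ultimately show ?thesis using card_image by metis
qed

lemma finite_states: "finite {f. state f}"
proof -
  have "{f. state f} \<subseteq> {f. set f \<subseteq> {1..n} \<times> {..<d} \<and> length f = n}"
  proof
    fix f assume "f \<in> {f. state f}"
    then have f: "state f" by simp
    then have "set (map fst f) = {1..n}" "\<forall>x \<in> set f. snd x < d" by (auto simp: state_def perm_list_def)
    then show "f \<in> {f. set f \<subseteq> {1..n} \<times> {..<d} \<and> length f = n}" using state_length[OF f] by force
  qed
  then show ?thesis using finite_lists_length_eq[of "{1..n} \<times> {..<d}" n] finite_subset by blast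
qed

lemma card_fc_Gddn_states:
  "card {g \<in> Gddn d n. fully_commutative d n g} = card {f. state f \<and> fc_word f \<and> d dvd sum_list (map snd f)}"
proof -
  define word where "word f = (SOME u. u \<in> reduced f)" for f
  have word: "word f \<in> lists {1..n}" "run (word f) start = f" if "state f" for f
  proof -
    have "word f \<in> reduced f" unfolding word_def using reduced_nonempty[OF that] by (rule someI_ex)
    then show "word f \<in> lists {1..n}" "run (word f) start = f" by (auto simp: reduced_def)
  qed
  let ?S = "{f. state f \<and> fc_word f \<and> d dvd sum_list (map snd f)}"
  have in_iff: "E u \<in> Gddn d n \<longleftrightarrow> d dvd sum_list (map snd (run u start))" if "u \<in> lists {1..n}" for u
    using Gddn_iff[OF that] colour_sum[OF that] by (simp add: dvd_eq_mod_eq_0)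
  have "(\<lambda>f. E (word f)) ` ?S = {g \<in> Gddn d n. fully_commutative d n g}"
  proof (intro equalityI subsetI)
    fix g assume "g \<in> (\<lambda>f. E (word f)) ` ?S"
    then show "g \<in> {g \<in> Gddn d n. fully_commutative d n g}"
      using word in_iff fully_commutative_iff by auto
  next
    fix g assume g: "g \<in> {g \<in> Gddn d n. fully_commutative d n g}"
    then have "g \<in> carrier G" by (simp add: fully_commutative_def)
    then obtain u where u: "u \<in> lists {1..n}" "g = E u" by (rule elt_surj)
    let ?f = "run u start"
    have f: "state ?f" using state_run[OF u(1) state_start] .
    have "?f \<in> ?S" using g u in_iff fully_commutative_iff f by simp
    moreover have "g = E (word ?f)" using u word[OF f] elt_eq_iff by metis
    ultimately show "g \<in> (\<lambda>f. E (word f)) ` ?S" by blast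
  qed
  moreover have "inj_on (\<lambda>f. E (word f)) ?S"
    using word elt_eq_iff by (intro inj_onI) (metis (no_types, lifting) mem_Collect_eq)
  ultimately show ?thesis by (simp flip: card_image)
qed

text \<open>
The sum over all colour sequences, arranged by the position of the first non-zero colour.
\<close>

lemma card_fc_Gddn:
  "card {g \<in> Gddn d n. fully_commutative d n g}
   = card (ballot_perms n n) + (\<Sum>k\<in>{0..n - 2}. (d - 1) * d ^ (n - 2 - k) * card (ballot_perms n k))"
proof -
  let ?Z = "{cs \<in> colour_lists n. d dvd sum_list cs}"
  have fin: "finite (fc_states cs)" for cs
    using finite_subset[OF _ finite_states, of "fc_states cs"] by (auto simp: fc_states_def)
  have finZ: "finite ?Z" using finite_colour_lists by simp
  have "{f. state f \<and> fc_word f \<and> d dvd sum_list (map snd f)} = (\<Union>cs\<in>?Z. fc_states cs)"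
    using state_length by (fastforce simp: fc_states_def colour_lists_def state_def)
  then have "card {g \<in> Gddn d n. fully_commutative d n g} = card (\<Union>cs\<in>?Z. fc_states cs)"
    using card_fc_Gddn_states by simp
  also have "\<dots> = (\<Sum>cs\<in>?Z. card (fc_states cs))"
    by (rule card_UN_disjoint) (use finZ fin in \<open>auto simp: fc_states_def\<close>)
  also have "\<dots> = card (fc_states (replicate n 0)) + (\<Sum>cs\<in>(\<Union>k\<in>{0..n - 2}. zero_sum_at k). card (fc_states cs))"
    unfolding zero_sum_partition
  proof (rule sum.insert)
    show "finite (\<Union>k\<in>{0..n - 2}. zero_sum_at k)"
      using finite_subset[OF _ finZ] unfolding zero_sum_partition by blast
    show "replicate n 0 \<notin> (\<Union>k\<in>{0..n - 2}. zero_sum_at k)"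
    proof
      assume "replicate n 0 \<in> (\<Union>k\<in>{0..n - 2}. zero_sum_at k)"
      then obtain k t cs' where "replicate n (0::nat) = replicate k 0 @ t # cs'" "t \<noteq> 0"
        by (auto simp: zero_sum_at_def)
      then have "t \<in> set (replicate n (0::nat))" by simp
      then show False using \<open>t \<noteq> 0\<close> by (simp split: if_splits)
    qed
  qed
  also have "(\<Sum>cs\<in>(\<Union>k\<in>{0..n - 2}. zero_sum_at k). card (fc_states cs))
      = (\<Sum>k\<in>{0..n - 2}. \<Sum>cs\<in>zero_sum_at k. card (fc_states cs))"
  proof (rule sum.UNION_disjoint)
    show "\<forall>k\<in>{0..n - 2}. finite (zero_sum_at k)"
      using finite_colour_lists by (simp add: zero_sum_at_def)
    show "\<forall>k\<in>{0..n - 2}. \<forall>k'\<in>{0..n - 2}. k \<noteq> k' \<longrightarrow> zero_sum_at k \<inter> zero_sum_at k' = {}"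
      using zero_sum_at_disjoint by blast
  qed simp
  also have "card (fc_states (replicate n 0)) = card (ballot_perms n n)"
  proof (rule card_fc_states)
    show "replicate n 0 \<in> colour_lists n" using d2 by (auto simp: colour_lists_def)
    fix f :: cword assume "map snd f = replicate n 0"
    then have "set (map snd f) \<subseteq> {0}" "length (map snd f) = n" by auto
    then have "\<not> coloured f" "length f = n" by (auto simp: coloured_def)
    then show "tail_sorted f \<longleftrightarrow> sorted (drop n (flat f))" using tail_sorted_uncoloured by simp
  qed
  also have "(\<Sum>k\<in>{0..n - 2}. \<Sum>cs\<in>zero_sum_at k. card (fc_states cs))
      = (\<Sum>k\<in>{0..n - 2}. (d - 1) * d ^ (n - 2 - k) * card (ballot_perms n k))"
  proof (rule sum.cong[OF HOL.refl])
    fix k assume "k \<in> {0..n - 2}"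
    then have k: "k + 2 \<le> n" using n3 by auto
    have "card (fc_states cs) = card (ballot_perms n k)" if "cs \<in> zero_sum_at k" for cs
    proof (rule card_fc_states)
      show "cs \<in> colour_lists n" using that by (simp add: zero_sum_at_def)
      from that obtain t cs' where "cs = replicate k 0 @ t # cs'" "0 < t" "\<exists>c \<in> set cs'. c \<noteq> 0"
        by (rule zero_sum_atE)
      then show "tail_sorted f \<longleftrightarrow> sorted (drop k (flat f))" if "map snd f = cs" for f :: cword
        using that tail_sorted_iff[of f k t cs'] by simp
    qed
    then show "(\<Sum>cs\<in>zero_sum_at k. card (fc_states cs)) = (d - 1) * d ^ (n - 2 - k) * card (ballot_perms n k)"
      using card_zero_sum_at[OF k] by simp
  qed
  finally show ?thesis .
qed

section \<open>Suffixes and packets\<close>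

abbreviation uncol :: "nat \<Rightarrow> nat \<times> nat" where "uncol \<equiv> \<lambda>w. (w, 0)"

lemma run_bubble:
  "length pre = m - 1 \<Longrightarrow> 1 \<le> m \<Longrightarrow> m + length mid \<le> n \<Longrightarrow>
   run (rev [m..<m + length mid]) (pre @ mid @ x # post) = pre @ x # mid @ post"
proof (induction mid arbitrary: post rule: rev_induct)
  case (snoc y mid)
  let ?i = "m + length mid"
  have "rev [m..<m + length (mid @ [y])] = ?i # rev [m..<?i]" by simp
  moreover have "act ?i ((pre @ mid) @ y # x # post) = (pre @ mid) @ x # y # post"
    by (rule sact_swap) (use snoc.prems in auto)
  ultimately show ?case using snoc by simp
qed simp

lemma run_nseg:
  assumes "length pre = m - 1" "1 \<le> m" "m + length mid = n" "k < d"
  shows "run (nseg n k m) (pre @ mid @ [(w, 0)]) = pre @ (w, k) # mid"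
proof -
  have "run (replicate k n) ((pre @ mid) @ [(w, 0)]) = (pre @ mid) @ [(w, k)]"
    using run_replicate[of "pre @ mid" 0 k w] assms d2 by simp
  moreover have "seg (n - 1) m = rev [m..<m + length mid]" using assms n3 by (simp add: seg_def)
  ultimately show ?thesis using run_bubble[OF assms(1,2), of mid "(w, k)" "[]"] assms(3)
    by (simp add: nseg_def)
qed

text \<open>
The part of a suffix that concerns positions from \<open>m\<close> on distributes the remaining uncoloured entries
\<open>ws\<close> over these positions according to the colours.
\<close>

lemma run_suffix_word:
  "length pre = m - 1 \<Longrightarrow> 1 \<le> m \<Longrightarrow> m + length cs = n + 1 \<Longrightarrow> length ws = length cs \<Longrightarrow> set cs \<subseteq> {..<d} \<Longrightarrow>
   run (suffix_word n (data_of m cs)) (pre @ map uncol ws) = pre @ place cs ws"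
proof (induction cs arbitrary: m pre ws)
  case Nil
  then show ?case by (simp add: suffix_word_def)
next
  case (Cons c cs)
  show ?case
  proof (cases "c = 0")
    case True
    obtain w ws' where ws: "ws = w # ws'" using Cons.prems by (cases ws) auto
    have "run (suffix_word n (data_of (Suc m) cs)) ((pre @ [uncol w]) @ map uncol ws') = (pre @ [uncol w]) @ place cs ws'"
      by (rule Cons.IH) (use Cons.prems ws in auto)
    then show ?thesis using True ws by simp
  next
    case False
    obtain ws' w where ws: "ws = ws' @ [w]" using Cons.prems by (cases ws rule: rev_cases) auto
    have "run (nseg n c m) (pre @ map uncol ws' @ [(w, 0)]) = pre @ (w, c) # map uncol ws'"
      by (rule run_nseg) (use Cons.prems ws in auto)
    moreover have "run (suffix_word n (data_of (Suc m) cs)) ((pre @ [(w, c)]) @ map uncol ws') = (pre @ [(w, c)]) @ place cs ws'"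
      by (rule Cons.IH) (use Cons.prems ws in auto)
    ultimately show ?thesis using False ws by (simp add: suffix_word_def)
  qed
qed

text \<open>
The suffix with the given sequence of colours.
\<close>

abbreviation label_word :: "nat list \<Rightarrow> nat list" where "label_word cs \<equiv> suffix_word n (data_of 1 cs)"

lemma run_label_word: "cs \<in> colour_lists n \<Longrightarrow> run (label_word cs) start = place cs [1..<Suc n]"
  using run_suffix_word[of "[]" 1 cs "[1..<Suc n]"] by (auto simp: colour_lists_def start_def)

lemma suffix_data_data_of: "cs \<in> colour_lists n \<Longrightarrow> suffix_data d n (data_of 1 cs)"
  using data_of_bounds[of _ _ 1 cs] data_of_sorted[of 1 cs]
  by (fastforce simp: suffix_data_def colour_lists_def)

text \<open>
Suffix data record the positions and values of the non-zero colours in a colour sequence, here with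
positions starting from \<open>m\<close>.
\<close>

lemma data_of_surj:
  "sorted_wrt (<) (map snd kjs) \<Longrightarrow> \<forall>(k, j) \<in> set kjs. 1 \<le> k \<and> k \<le> d - 1 \<and> m \<le> j \<and> j < m + r \<Longrightarrow>
   \<exists>cs \<in> colour_lists r. kjs = data_of m cs"
proof (induction r arbitrary: m kjs)
  case 0
  then have "kjs = []" by (cases kjs) auto
  then show ?case by (simp add: colour_lists_def)
next
  case (Suc r)
  show ?case
  proof (cases "\<exists>k rest. kjs = (k, m) # rest")
    case True
    then obtain k rest where k: "kjs = (k, m) # rest" by blast
    have "\<forall>(k, j) \<in> set rest. 1 \<le> k \<and> k \<le> d - 1 \<and> Suc m \<le> j \<and> j < Suc m + r"
      using Suc.prems k by fastforce
    then obtain cs where "cs \<in> colour_lists r" "rest = data_of (Suc m) cs"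
      using Suc.IH[of rest "Suc m"] Suc.prems k by auto
    then show ?thesis using Suc.prems k d2 by (intro bexI[of _ "k # cs"]) (auto simp: colour_lists_def)
  next
    case False
    have "m \<noteq> j" if kj: "(k, j) \<in> set kjs" for k j
    proof
      assume j: "m = j"
      obtain k' j' rest where kjs: "kjs = (k', j') # rest" using kj by (cases kjs) auto
      then have "j' \<noteq> m" "m \<le> j'" using False Suc.prems by auto
      then show False using Suc.prems(1) kjs kj j by fastforce
    qed
    then have "\<forall>(k, j) \<in> set kjs. 1 \<le> k \<and> k \<le> d - 1 \<and> Suc m \<le> j \<and> j < Suc m + r"
      using Suc.prems(2) by fastforce
    then obtain cs where "cs \<in> colour_lists r" "kjs = data_of (Suc m) cs"
      using Suc.IH[of kjs "Suc m"] Suc.prems by auto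
    then show ?thesis using d2 by (intro bexI[of _ "0 # cs"]) (auto simp: colour_lists_def)
  qed
qed

lemma suffix_data_surj:
  assumes "suffix_data d n kjs"
  obtains cs where "cs \<in> colour_lists n" "kjs = data_of 1 cs"
proof -
  have "sorted_wrt (<) (map snd kjs)" "\<forall>(k, j) \<in> set kjs. 1 \<le> k \<and> k \<le> d - 1 \<and> 1 \<le> j \<and> j < 1 + n"
    using assms unfolding suffix_data_def by auto
  from data_of_surj[OF this] that show ?thesis by blast
qed

lemma label_word_lists: "cs \<in> colour_lists n \<Longrightarrow> label_word cs \<in> lists {1..n}"
proof -
  assume cs: "cs \<in> colour_lists n"
  have "set (nseg n k j) \<subseteq> {1..n}" if "1 \<le> j" for k j
    using that n3 by (auto simp: nseg_def seg_def)
  then show "label_word cs \<in> lists {1..n}"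
    using data_of_bounds[of _ _ 1 cs] by (fastforce simp: suffix_word_def)
qed

lemma count_nseg: "count_list (nseg n k j) n = k"
proof -
  have "n \<notin> set (seg (n - 1) j)" using n3 by (auto simp: seg_def)
  then show ?thesis by (simp add: nseg_def count_notin) (simp add: count_list_eq_length_filter)
qed

lemma count_suffix_word: "count_list (suffix_word n (data_of m cs)) n = sum_list cs"
  by (induction cs arbitrary: m) (auto simp: suffix_word_def count_nseg)

lemma label_word_inj: "inj_on label_word (colour_lists n)"
proof (rule inj_onI)
  fix cs cs' assume "cs \<in> colour_lists n" "cs' \<in> colour_lists n" "label_word cs = label_word cs'"
  then have "map snd (place cs [1..<Suc n]) = map snd (place cs' [1..<Suc n])"
    using run_label_word by metis
  then show "cs = cs'" by (simp add: colours_place)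
qed

text \<open>
With the empty prefix the flattened word is increasing, so the pattern condition holds trivially.
\<close>

lemma label_word_fully_commutative: "cs \<in> colour_lists n \<Longrightarrow> fully_commutative d n (E (label_word cs))"
proof -
  assume cs: "cs \<in> colour_lists n"
  have "flat (place cs [1..<Suc n]) = [1..<Suc n]"
    using cs by (intro flat_place) (simp add: colour_lists_def)
  then have "fc_word (run (label_word cs) start)"
    unfolding run_label_word[OF cs] fc_word_def by (simp add: avoids321_sorted tail_sorted_sorted del: upt_Suc)
  then show ?thesis using fully_commutative_iff label_word_lists cs by blast
qed

lemma Nil_prefix: "[] \<in> prefixes n"
proof -
  have "concat (map (\<lambda>p. seg p (p + 1)) [1..<n]) = []" by (simp add: seg_def)
  then show ?thesis unfolding prefixes_def by (intro CollectI exI[of _ "\<lambda>p. p + 1"]) auto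
qed

lemma prefix_letters: "p \<in> prefixes n \<Longrightarrow> set p \<subseteq> {1..n - 1}"
proof
  fix x assume "p \<in> prefixes n" "x \<in> set p"
  then obtain i where i: "p = concat (map (\<lambda>q. seg q (i q)) [1..<n])" "\<forall>q \<in> {1..n - 1}. 1 \<le> i q \<and> i q \<le> q + 1"
    unfolding prefixes_def by blast
  with \<open>x \<in> set p\<close> obtain q where q: "q \<in> {1..<n}" "x \<in> set (seg q (i q))" by auto
  then have "1 \<le> i q" using i(2) by auto
  then show "x \<in> {1..n - 1}" using q by (auto simp: seg_def)
qed

definition labels :: "nat list set" where
  "labels = label_word ` colour_lists n"

lemma label_in_collection: "q \<in> labels \<Longrightarrow> q \<in> collection d n q"
proof -
  assume "q \<in> labels"
  then obtain cs where cs: "q = label_word cs" "cs \<in> colour_lists n" by (auto simp: labels_def)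
  then have "q \<in> suffixes d n" using suffix_data_data_of by (auto simp: suffixes_def)
  then have "q \<in> canonical_words d n"
    using Nil_prefix unfolding canonical_words_def by (metis (mono_tags, lifting) append_Nil mem_Collect_eq)
  then show ?thesis using Nil_prefix label_word_fully_commutative cs
    unfolding collection_def by (metis (mono_tags, lifting) append_Nil mem_Collect_eq)
qed

text \<open>
Every label belongs to its own collection, and words in a collection end in its label. Two labels
with the same collection are therefore suffixes of each other.
\<close>

lemma collection_inj: "inj_on (collection d n) labels"
proof (rule inj_onI)
  fix q q' assume q: "q \<in> labels" "q' \<in> labels" "collection d n q = collection d n q'"
  then have "q \<in> collection d n q'" "q' \<in> collection d n q" using label_in_collection by blast+
  then obtain p p' where "q = p @ q'" "q' = p' @ q" unfolding collection_def by blast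
  then show "q = q'" by simp
qed

text \<open>
Prefixes do not involve \<open>s_n\<close>, so all elements of a collection have the same colour sum as the label.
\<close>

lemma collection_subset_iff:
  assumes q: "q \<in> labels"
  shows "elt d n ` collection d n q \<subseteq> Gddn d n \<longleftrightarrow> d dvd count_list q n"
proof -
  have ql: "q \<in> lists {1..n}" using q label_word_lists by (auto simp: labels_def)
  have "E w \<in> Gddn d n \<longleftrightarrow> d dvd count_list q n" if in_coll: "w \<in> collection d n q" for w
  proof -
    obtain p where w: "w = p @ q" "p \<in> prefixes n" using in_coll unfolding collection_def by blast
    have p: "set p \<subseteq> {1..n - 1}" using prefix_letters[OF w(2)] .
    moreover have "{1..n - 1} \<subseteq> {1..n}" "n \<notin> {1..n - 1}" using n3 by auto
    ultimately have "p \<in> lists {1..n}" "n \<notin> set p" by blast+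
    then show ?thesis using Gddn_iff[of w] w ql by (simp add: count_notin)
  qed
  then show ?thesis using label_in_collection[OF q] by blast
qed

lemma suffix_word_label: "suffix_data d n kjs \<Longrightarrow> suffix_word n kjs \<in> labels"
  by (elim suffix_data_surj) (simp add: labels_def)

lemma nseg_label: "t \<in> {1..d - 1} \<Longrightarrow> j \<in> {1..n} \<Longrightarrow> nseg n t j \<in> labels"
  using suffix_word_label[of "[(t, j)]"] by (simp add: suffix_data_def suffix_word_def)

lemma nseg_last: "nseg n t n = replicate t n" "nseg n t (n - 1) = replicate t n @ [n - 1]"
  using n3 by (cases n; simp add: nseg_def seg_def)+

lemma packet_labels_subset: "packet_labels d n k \<subseteq> labels"
proof -
  have 1: "{suffix_word n kjs |kjs. suffix_data d n kjs \<and> P kjs} \<subseteq> labels" for P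
    using suffix_word_label by blast
  have "nseg n t n \<in> labels" "nseg n t (n - 1) \<in> labels" if "t \<in> {1..d - 1}" for t
    by (rule nseg_label[OF that]; use n3 in simp)+
  then have 2: "{replicate t n |t. t \<in> {1..d - 1}} \<union> {replicate t n @ [n - 1] |t. t \<in> {1..d - 1}} \<subseteq> labels"
    unfolding nseg_last by blast
  have 3: "[] \<in> labels"
    using suffix_word_label[of "[]"] by (simp add: suffix_data_def suffix_word_def)
  have 4: "{nseg n t k |t. t \<in> {1..d - 1}} \<subseteq> labels" if "k \<noteq> 0" "k \<le> n - 2"
    using nseg_label[of _ k] that by auto
  show ?thesis unfolding packet_labels_def using 1 2 3 4 by auto
qed

text \<open>
Packets consist of collections; counting labels instead is justified by \<open>collection_inj\<close>.
\<close>

lemma card_packet: "card (packet d n k) = card {q \<in> packet_labels d n k. d dvd count_list q n}"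
proof -
  have "packet d n k = collection d n ` {q \<in> packet_labels d n k. d dvd count_list q n}"
    using packet_labels_subset collection_subset_iff unfolding packet_def packet_Gd1n_def by blast
  moreover have "inj_on (collection d n) {q \<in> packet_labels d n k. d dvd count_list q n}"
    using packet_labels_subset by (intro inj_on_subset[OF collection_inj]) blast
  ultimately show ?thesis by (simp add: card_image)
qed

lemma not_dvd_nseg: "t \<in> {1..d - 1} \<Longrightarrow> \<not> d dvd count_list (nseg n t j) n"
  using d2 by (auto simp: count_nseg dest!: dvd_imp_le)

text \<open>
The labels with a single coloured position drop out, since their colour sum is between \<open>1\<close> and \<open>d - 1\<close>.
\<close>

lemma zero_sum_labels:
  assumes k: "k \<le> n - 2"
  shows "{q \<in> packet_labels d n k. d dvd count_list q n} = label_word ` zero_sum_at k"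
proof -
  let ?L = "{suffix_word n kjs |kjs. suffix_data d n kjs \<and> length kjs \<ge> 2 \<and> snd (hd kjs) = k + 1}"
  have "{q \<in> packet_labels d n k. d dvd count_list q n} = {q \<in> ?L. d dvd count_list q n}"
  proof -
    have "packet_labels d n k = (if k = 0 then ?L else {nseg n t k |t. t \<in> {1..d - 1}} \<union> ?L)"
      using k by (simp add: packet_labels_def)
    moreover have "{q \<in> {nseg n t k |t. t \<in> {1..d - 1}}. d dvd count_list q n} = {}"
      using not_dvd_nseg by blast
    ultimately show ?thesis by (simp only: split: if_split) blast
  qed
  also have "\<dots> = label_word ` zero_sum_at k"
  proof (intro equalityI subsetI)
    fix q assume "q \<in> {q \<in> ?L. d dvd count_list q n}"
    then obtain kjs where kjs: "q = suffix_word n kjs" "suffix_data d n kjs" "length kjs \<ge> 2"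
      "snd (hd kjs) = k + 1" "d dvd count_list q n" by blast
    then obtain cs where cs: "cs \<in> colour_lists n" "kjs = data_of 1 cs" by (elim suffix_data_surj)
    have "data_of 1 cs \<noteq> []" using kjs cs by auto
    then have "\<exists>c \<in> set cs. c \<noteq> 0" using data_of_eq_Nil by blast
    then obtain zs t cs' where z: "cs = zs @ t # cs'" "t \<noteq> 0" "\<forall>z \<in> set zs. z = 0"
      using split_list_first_prop[of cs "\<lambda>c. c \<noteq> 0"] by auto
    then have zr: "zs = replicate (length zs) 0" by (simp add: replicate_eqI)
    have "kjs = data_of (1 + length zs) (t # cs')"
      unfolding cs(2) z(1) by (subst zr) (rule data_of_zeros)
    then have "length zs = k" using kjs(4) z(2) by simp
    then have "cs \<in> zero_sum_at k"
      using cs kjs(1,5) z zr count_suffix_word by (auto simp: zero_sum_at_def)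
    then show "q \<in> label_word ` zero_sum_at k" using kjs cs by blast
  next
    fix q assume "q \<in> label_word ` zero_sum_at k"
    then obtain cs where cs: "cs \<in> zero_sum_at k" "q = label_word cs" by blast
    then have csl: "cs \<in> colour_lists n" "d dvd sum_list cs" by (auto simp: zero_sum_at_def)
    from cs(1) obtain t cs' where z: "cs = replicate k 0 @ t # cs'" "0 < t" "\<exists>c \<in> set cs'. c \<noteq> 0"
      by (rule zero_sum_atE)
    have "data_of 1 cs = (t, k + 1) # data_of (k + 2) cs'"
      unfolding z(1) data_of_zeros using z(2) by simp
    moreover obtain y ys where "data_of (k + 2) cs' = y # ys"
      using z(3) data_of_eq_Nil by (metis neq_Nil_conv)
    ultimately have data: "data_of 1 cs = (t, k + 1) # y # ys" by (simp only:)
    have "length (data_of 1 cs) \<ge> 2" "snd (hd (data_of 1 cs)) = k + 1"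
      unfolding data by simp_all
    then have "q \<in> ?L" using suffix_data_data_of[OF csl(1)] cs(2) by blast
    moreover have "d dvd count_list q n" using csl(2) cs(2) count_suffix_word by metis
    ultimately show "q \<in> {q \<in> ?L. d dvd count_list q n}" by blast
  qed
  finally show ?thesis .
qed

lemma card_packet_small: 
  assumes "k \<le> n - 2" shows "card (packet d n k) = (d - 1) * d ^ (n - 2 - k)"
proof -
  have "inj_on label_word (zero_sum_at k)"
    by (rule inj_on_subset[OF label_word_inj]) (auto simp: zero_sum_at_def)
  then show ?thesis
    using card_zero_sum_at[of k] assms n3 by (simp add: card_packet zero_sum_labels card_image)
qed

lemma card_packet_penultimate: "card (packet d n (n - 1)) = 0"
proof -
  have neq: "n - 1 \<noteq> 0" "\<not> n - 1 \<le> n - 2" using n3 by linarith+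
  have labels: "packet_labels d n (n - 1) = {nseg n t n | t. t \<in> {1..d - 1}} \<union> {nseg n t (n - 1) | t. t \<in> {1..d - 1}}"
    using neq unfolding nseg_last by (simp add: packet_labels_def)
  have "\<not> d dvd count_list q n" if "q \<in> packet_labels d n (n - 1)" for q
    using that not_dvd_nseg unfolding labels by blast
  then have none: "{q \<in> packet_labels d n (n - 1). d dvd count_list q n} = {}" by blast
  show ?thesis unfolding card_packet none by (rule card.empty)
qed

lemma card_packet_last: "card (packet d n n) = 1"
proof -
  have "n \<noteq> 0" "\<not> n \<le> n - 2" "n \<noteq> n - 1" using n3 by linarith+
  then have labels: "packet_labels d n n = {[]}" by (simp add: packet_labels_def)
  have "{q \<in> {[]}. d dvd count_list q n} = {[]}" by auto
  then show ?thesis unfolding card_packet labels by simp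
qed

section \<open>Comparison of the two counts\<close>

lemma packet_sum:
  "(\<Sum>k = 0..n. catalan_triangle n k * real (card (packet d n k)))
   = (\<Sum>k = 0..n - 2. catalan_triangle n k * real ((d - 1) * d ^ (n - 2 - k))) + catalan_triangle n n"
proof -
  have "{0..n} = insert n (insert (n - 1) {0..n - 2})" using n3 by auto
  moreover have "n \<notin> insert (n - 1) {0..n - 2}" "n - 1 \<notin> {0..n - 2}" using n3 by auto
  ultimately show ?thesis by (simp add: card_packet_penultimate card_packet_last card_packet_small del: One_nat_def)
qed

lemma card_fully_commutative_Gddn:
  "real (card {g \<in> Gddn d n. fully_commutative d n g})
     = (\<Sum>k = 0..n. catalan_triangle n k * real (card (packet d n k)))
   \<and> (\<Sum>k = 0..n. catalan_triangle n k * real (card (packet d n k)))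
     = (real d - 1) * catalan_poly n (n - 2) (real d) + catalan n"
proof
  have "real (card {g \<in> Gddn d n. fully_commutative d n g})
      = catalan_triangle n n + (\<Sum>k\<in>{0..n - 2}. real ((d - 1) * d ^ (n - 2 - k)) * catalan_triangle n k)"
    unfolding card_fc_Gddn by (simp add: card_ballot_perms)
  then show "real (card {g \<in> Gddn d n. fully_commutative d n g})
     = (\<Sum>k = 0..n. catalan_triangle n k * real (card (packet d n k)))"
    unfolding packet_sum by (simp add: mult.commute)
  have "real (d - 1) = real d - 1" using d2 by (simp add: of_nat_diff)
  then show "(\<Sum>k = 0..n. catalan_triangle n k * real (card (packet d n k)))
     = (real d - 1) * catalan_poly n (n - 2) (real d) + catalan n"
    unfolding packet_sum catalan_poly_def catalan_triangle_catalan
    by (simp add: sum_distrib_left mult_ac)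
qed

end

theorem corollary5p3:
  fixes d n :: nat
  assumes "d \<ge> 2" and "n \<ge> 3"
  shows "real (card {g \<in> Gddn d n. fully_commutative d n g})
           = (\<Sum>k = 0..n. catalan_triangle n k * real (card (packet d n k)))
       \<and> (\<Sum>k = 0..n. catalan_triangle n k * real (card (packet d n k)))
           = (real d - 1) * catalan_poly n (n - 2) (real d) + catalan n"
proof -
  interpret coloured_words d n using assms by unfold_locales
  show ?thesis by (rule card_fully_commutative_Gddn)
qed

end
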